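(* Let $u_0\in L^2(\Omega)$ be a probability density and for each $n$ let $u_n$ be the solution of $\partial_tu_n(t,x)=L_nu_n(t,x)$ for $t>0$, $x\in\overline\Omega$, with $u_n(0,x)=u_0(x)$. There exist two constants $A>0$ (depending only on the domain and the kernels) and $C>0$ (depending on the initial condition) such that, for every $n$ and every $t\ge0$, $$\Big\|u_n(t,\cdot)-\frac1{|\Omega|}\Big\|^2_{L^2(\Omega)}\le Ce^{-At}.$$
   Context: $\Omega\subset\mathbb R^N$ is a bounded domain. Each kernel $V\in\{J,G,R\}$ is a function $V:\mathbb R^N\times\mathbb R^N\to\mathbb R$ that is continuous, non-negative, symmetric ($V(x,y)=V(y,x)$), satisfies $V(x,x)>0$ for every $x$, and $\int_{\mathbb R^N}V(x,y)\,dy=1$ for every $x$. For each $n$, $\overline\Omega=A_n\cup B_n$ with $A_n\cap B_n=\emptyset$, $B_n$ open with Lipschitz boundary (so $|\partial A_n\cap\Omega|=|\partial B_n\cap\Omega|=0$). It is assumed that $\chi_{A_n}\rightharpoonup X$ and $\chi_{B_n}\rightharpoonup 1-X$ weakly in $L^\infty(\overline\Omega)$ (i.e. tested against $L^1$ functions), with $0<X(x)<1$. The operator $L_n$ is $$\begin{aligned}L_nf(x)=&\chi_{A_n}(x)\int_\Omega\chi_{A_n}(y)J(x,y)(f(y)-f(x))dy+\chi_{B_n}(x)\int_\Omega\chi_{B_n}(y)G(x,y)(f(y)-f(x))dy\\&+\chi_{A_n}(x)\int_\Omega\chi_{B_n}(y)R(x,y)(f(y)-f(x))dy+\chi_{B_n}(x)\int_\Omega\chi_{A_n}(y)R(x,y)(f(y)-f(x))dy.\end{aligned}$$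 *)

theory Defs
  imports "HOL-Analysis.Analysis"
begin

definition bounded_domain :: "'a::euclidean_space set \<Rightarrow> bool" where
  "bounded_domain \<Omega> \<longleftrightarrow> open \<Omega> \<and> connected \<Omega> \<and> \<Omega> \<noteq> {} \<and> bounded \<Omega>"

definition admissible_kernel :: "('a::euclidean_space \<Rightarrow> 'a \<Rightarrow> real) \<Rightarrow> bool" where
  "admissible_kernel V \<longleftrightarrow>
     continuous_on UNIV (\<lambda>(x, y). V x y) \<and>
     (\<forall>x y. 0 \<le> V x y) \<and>
     (\<forall>x y. V x y = V y x) \<and>
     (\<forall>x. 0 < V x x) \<and>
     (\<forall>x. has_bochner_integral lebesgue (V x) 1)"

text \<open>
  Near every boundary point the set is, in suitable orthonormal coordinates, the region above
  the graph of a Lipschitz function. Here \<open>e\<close> is the vertical unit vector and \<open>\<phi>\<close> lives on the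
  hyperplane orthogonal to \<open>e\<close>.
\<close>
definition lipschitz_boundary :: "'a::euclidean_space set \<Rightarrow> bool" where
  "lipschitz_boundary S \<longleftrightarrow>
     (\<forall>p\<in>frontier S. \<exists>r>0. \<exists>e K. \<exists>\<phi> :: 'a \<Rightarrow> real.
        norm e = 1 \<and>
        K-lipschitz_on {y. y \<bullet> e = 0} \<phi> \<and>
        (\<forall>x\<in>ball p r. x \<in> S \<longleftrightarrow> \<phi> (x - (x \<bullet> e) *\<^sub>R e) < x \<bullet> e))"

definition admissible_partition :: "'a::euclidean_space set \<Rightarrow> 'a set \<Rightarrow> 'a set \<Rightarrow> bool" where
  "admissible_partition \<Omega> A B \<longleftrightarrow>
     closure \<Omega> = A \<union> B \<and> A \<inter> B = {} \<and> open B \<and> lipschitz_boundary B"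

text \<open>Weak convergence in \<open>L\<^sup>\<infinity>(S)\<close>, i.e. tested against functions in \<open>L\<^sup>1(S)\<close>.\<close>
definition weak_conv_Linf ::
    "'a::euclidean_space set \<Rightarrow> (nat \<Rightarrow> 'a \<Rightarrow> real) \<Rightarrow> ('a \<Rightarrow> real) \<Rightarrow> bool" where
  "weak_conv_Linf S f g \<longleftrightarrow>
     (\<forall>\<psi>. integrable (lebesgue_on S) \<psi> \<longrightarrow>
        (\<lambda>n. LINT x|lebesgue_on S. f n x * \<psi> x) \<longlonglongrightarrow> (LINT x|lebesgue_on S. g x * \<psi> x))"

definition mixture_limit ::
    "'a::euclidean_space set \<Rightarrow> (nat \<Rightarrow> 'a set) \<Rightarrow> (nat \<Rightarrow> 'a set) \<Rightarrow> ('a \<Rightarrow> real) \<Rightarrow> bool" where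
  "mixture_limit \<Omega> A B X \<longleftrightarrow>
     X \<in> borel_measurable (lebesgue_on (closure \<Omega>)) \<and>
     (AE x in lebesgue_on (closure \<Omega>). 0 < X x \<and> X x < 1) \<and>
     weak_conv_Linf (closure \<Omega>) (\<lambda>n. indicator (A n)) X \<and>
     weak_conv_Linf (closure \<Omega>) (\<lambda>n. indicator (B n)) (\<lambda>x. 1 - X x)"

definition nonlocal_op ::
    "'a::euclidean_space set \<Rightarrow> ('a \<Rightarrow> 'a \<Rightarrow> real) \<Rightarrow> ('a \<Rightarrow> 'a \<Rightarrow> real) \<Rightarrow> ('a \<Rightarrow> 'a \<Rightarrow> real) \<Rightarrow>
     'a set \<Rightarrow> 'a set \<Rightarrow> ('a \<Rightarrow> real) \<Rightarrow> 'a \<Rightarrow> real" where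
  "nonlocal_op \<Omega> J G R A B f x =
     indicator A x * (LINT y|lebesgue_on \<Omega>. indicator A y * J x y * (f y - f x)) +
     indicator B x * (LINT y|lebesgue_on \<Omega>. indicator B y * G x y * (f y - f x)) +
     indicator A x * (LINT y|lebesgue_on \<Omega>. indicator B y * R x y * (f y - f x)) +
     indicator B x * (LINT y|lebesgue_on \<Omega>. indicator A y * R x y * (f y - f x))"

text \<open>Elements of \<open>L\<^sup>2(\<Omega>)\<close> are represented by functions rather than by classes modulo null sets.\<close>
definition in_L2 :: "'a::euclidean_space set \<Rightarrow> ('a \<Rightarrow> real) \<Rightarrow> bool" where
  "in_L2 \<Omega> f \<longleftrightarrow>
     f \<in> borel_measurable (lebesgue_on \<Omega>) \<and> integrable (lebesgue_on \<Omega>) (\<lambda>x. (f x)\<^sup>2)"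

definition L2_norm :: "'a::euclidean_space set \<Rightarrow> ('a \<Rightarrow> real) \<Rightarrow> real" where
  "L2_norm \<Omega> f = sqrt (LINT x|lebesgue_on \<Omega>. (f x)\<^sup>2)"

definition probability_density :: "'a::euclidean_space set \<Rightarrow> ('a \<Rightarrow> real) \<Rightarrow> bool" where
  "probability_density \<Omega> f \<longleftrightarrow>
     (AE x in lebesgue_on \<Omega>. 0 \<le> f x) \<and> has_bochner_integral (lebesgue_on \<Omega>) f 1"

text \<open>
  The evolution problem \<open>\<partial>\<^sub>t u = L u\<close>, \<open>u(0) = u\<^sub>0\<close>, understood in \<open>L\<^sup>2(\<Omega>)\<close>: a trajectory that is
  continuous from \<open>[0, \<infinity>)\<close> to \<open>L\<^sup>2(\<Omega>)\<close> and, for \<open>t > 0\<close>, differentiable in \<open>L\<^sup>2(\<Omega>)\<close> with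
  derivative \<open>L u(t)\<close>. For \<open>x\<close> in \<open>\<Omega>\<close> the operator only reads values on \<open>\<Omega>\<close>, so the values
  of \<open>u\<close> on the boundary play no role.
\<close>
definition L2_solution ::
    "'a::euclidean_space set \<Rightarrow> (('a \<Rightarrow> real) \<Rightarrow> 'a \<Rightarrow> real) \<Rightarrow> ('a \<Rightarrow> real) \<Rightarrow>
     (real \<Rightarrow> 'a \<Rightarrow> real) \<Rightarrow> bool" where
  "L2_solution \<Omega> L u0 u \<longleftrightarrow>
     (\<forall>t\<ge>0. in_L2 \<Omega> (u t)) \<and>
     (AE x in lebesgue_on \<Omega>. u 0 x = u0 x) \<and>
     (\<forall>t\<ge>0. ((\<lambda>s. L2_norm \<Omega> (\<lambda>x. u s x - u t x)) \<longlongrightarrow> 0) (at t within {0..})) \<and>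
     (\<forall>t>0. ((\<lambda>h. L2_norm \<Omega> (\<lambda>x. (u (t + h) x - u t x) / h - L (u t) x)) \<longlongrightarrow> 0) (at 0))"

end

theory Submission
  imports Defs
begin

text \<open>
  For a fixed partition, \<open>nonlocal_op\<close> is on \<open>\<Omega>\<close> a single jump operator
  \<open>L f x = \<integral> k x y * (f y - f x) dy\<close>, whose kernel \<open>k\<close> is \<open>J\<close>, \<open>G\<close> or \<open>R\<close> according to the
  phases of \<open>x\<close> and \<open>y\<close>. On \<open>\<Omega>\<close>, \<open>k\<close> is symmetric, and bounded because the three kernels are continuous on the
  compact set \<open>closure \<Omega>\<close>. Symmetry gives, by exchanging \<open>x\<close> and \<open>y\<close>, that \<open>L f\<close> has mean zero and
  that \<open>2 * \<langle>f, L f\<rangle> = - D f\<close> with \<open>D f = \<integral>\<integral> k x y * (f x - f y)\<^sup>2 dx dy\<close>. Hence mass is conserved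
  along a solution, \<open>w = u - 1 / |\<Omega>|\<close> keeps mean zero, and \<open>d/dt \<parallel>w\<parallel>\<^sup>2 = - D w\<close>.

  Exponential decay therefore follows from a spectral gap \<open>\<alpha> * \<parallel>f\<parallel>\<^sup>2 \<le> D f\<close> for \<open>f\<close> of mean zero, and
  the point is that \<open>\<alpha>\<close> must not depend on the partition. The partition enters only through \<open>k\<close>,
  and \<open>k\<close> is at least the minimum of the three kernels. That minimum is positive on the diagonal, so
  by compactness it is at least some \<open>\<delta> > 0\<close> whenever \<open>dist x y < r\<close>
  (\<open>compact_near_diagonal_lower_bound\<close>). So \<open>D f\<close> dominates \<open>\<delta>\<close> times the integral of
  \<open>(f x - f y)\<^sup>2\<close> over the pairs at distance less than \<open>r\<close>, and a Poincare inequality is needed that bounds the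
  integral over all pairs by this one (\<open>near_osc_int_controls_osc_int\<close>). The full integral
  is \<open>2 * |\<Omega>| * \<parallel>f\<parallel>\<^sup>2\<close> when \<open>f\<close> has mean zero, which yields \<open>jump_spectral_gap\<close>.

  For the Poincare inequality, consider for two centres \<open>a, b \<in> \<Omega>\<close> the integral over
  \<open>x\<close> in the ball around \<open>a\<close> and \<open>y\<close> in the ball around \<open>b\<close>, both of radius \<open>r / 3\<close> and cut down to \<open>\<Omega>\<close>.
  Being controlled by the short-range integral, uniformly in \<open>f\<close>, is an equivalence relation between the centres
  (transitivity inserts an intermediate point and averages over the ball that it ranges over),
  and it holds between close centres. Since \<open>\<Omega>\<close> is connected, any two centres are related; finitely
  many balls cover \<open>\<Omega>\<close>, which is bounded, and summing over pairs of balls finishes the argument.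
\<close>

section \<open>A Poincare inequality for short-range differences\<close>

lemma square_dist_le_via: "(a - b)\<^sup>2 \<le> 2 * (a - c)\<^sup>2 + 2 * (c - b)\<^sup>2" for a b c :: real
proof -
  have "2 * (a - c)\<^sup>2 + 2 * (c - b)\<^sup>2 - (a - b)\<^sup>2 = ((a - c) - (c - b))\<^sup>2"
    by (simp add: power2_eq_square algebra_simps)
  then show ?thesis
    by (smt (verit) zero_le_power2)
qed

lemma sq_diff_bound: "(a - b)\<^sup>2 \<le> 2 * a\<^sup>2 + 2 * b\<^sup>2" for a b :: real
  using square_dist_le_via[of a b 0] by simp

text \<open>
  With values in \<open>ennreal\<close>, Fubini and monotonicity apply to every measurable \<open>f\<close>; integrability enters only
  when the inequality is translated to \<open>L2_norm\<close> and \<open>dirichlet_form\<close>.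
\<close>
definition osc_int :: "'b measure \<Rightarrow> ('b \<Rightarrow> real) \<Rightarrow> 'b set \<Rightarrow> 'b set \<Rightarrow> ennreal" where
  "osc_int M f S T =
     (\<integral>\<^sup>+x. \<integral>\<^sup>+y. indicator S x * indicator T y * ennreal ((f x - f y)\<^sup>2) \<partial>M \<partial>M)"

definition near_osc_int :: "'b::euclidean_space measure \<Rightarrow> real \<Rightarrow> ('b \<Rightarrow> real) \<Rightarrow> ennreal" where
  "near_osc_int M r f =
     (\<integral>\<^sup>+x. \<integral>\<^sup>+y. indicator {p. dist (fst p) (snd p) < r} (x, y) * ennreal ((f x - f y)\<^sup>2) \<partial>M \<partial>M)"

text \<open>
  Integrate \<open>square_dist_le_via\<close> over \<open>x \<in> S\<close>, \<open>y \<in> T\<close> and an intermediate point \<open>z \<in> U\<close>; each term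
  leaves one variable free, whose integration produces the measure of its set.
\<close>
lemma (in sigma_finite_measure) osc_int_triangle:
  assumes f[measurable]: "f \<in> borel_measurable M"
    and [measurable]: "S \<in> sets M" "T \<in> sets M" "U \<in> sets M"
  shows "emeasure M U * osc_int M f S T
         \<le> 2 * emeasure M T * osc_int M f S U + 2 * emeasure M S * osc_int M f U T"
proof -
  interpret P: pair_sigma_finite M M ..
  let ?q = "\<lambda>S T x y. indicator S x * indicator T y * ennreal ((f x - f y)\<^sup>2)"
  define H where "H x = (\<integral>\<^sup>+z. ?q S U x z \<partial>M)" for x
  define K where "K y = (\<integral>\<^sup>+z. ?q U T z y \<partial>M)" for y
  have [measurable]: "H \<in> borel_measurable M" "K \<in> borel_measurable M"
    unfolding H_def K_def by measurable
  have pw: "?q S T x y * indicator U z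
      \<le> 2 * indicator T y * ?q S U x z + 2 * indicator S x * ?q U T z y" for x y z
  proof -
    have "ennreal ((f x - f y)\<^sup>2) \<le> ennreal (2 * (f x - f z)\<^sup>2 + 2 * (f z - f y)\<^sup>2)"
      by (rule ennreal_leI) (rule square_dist_le_via)
    also have "\<dots> = 2 * ennreal ((f x - f z)\<^sup>2) + 2 * ennreal ((f z - f y)\<^sup>2)"
      by (simp add: ennreal_mult)
    finally show ?thesis
      by (auto simp: indicator_def)
  qed
  have "emeasure M U * osc_int M f S T = (\<integral>\<^sup>+x. \<integral>\<^sup>+y. \<integral>\<^sup>+z. ?q S T x y * indicator U z \<partial>M \<partial>M \<partial>M)"
    unfolding osc_int_def
    by (simp add: nn_integral_cmult nn_integral_multc mult.commute[of "emeasure M U"])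
  also have "\<dots> \<le> (\<integral>\<^sup>+x. \<integral>\<^sup>+y. \<integral>\<^sup>+z. 2 * indicator T y * ?q S U x z + 2 * indicator S x * ?q U T z y \<partial>M \<partial>M \<partial>M)"
    by (intro nn_integral_mono pw)
  also have "\<dots> = (\<integral>\<^sup>+x. \<integral>\<^sup>+y. 2 * indicator T y * H x + 2 * indicator S x * K y \<partial>M \<partial>M)"
    unfolding H_def K_def by (simp add: nn_integral_add nn_integral_cmult)
  also have "\<dots> = (\<integral>\<^sup>+x. 2 * emeasure M T * H x + 2 * indicator S x * (\<integral>\<^sup>+y. K y \<partial>M) \<partial>M)"
    by (simp add: nn_integral_add nn_integral_cmult nn_integral_multc)
  also have "\<dots> = 2 * emeasure M T * (\<integral>\<^sup>+x. H x \<partial>M) + 2 * emeasure M S * (\<integral>\<^sup>+y. K y \<partial>M)"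
    by (simp add: nn_integral_add nn_integral_cmult nn_integral_multc)
  also have "(\<integral>\<^sup>+x. H x \<partial>M) = osc_int M f S U"
    by (simp add: H_def osc_int_def)
  also have "(\<integral>\<^sup>+y. K y \<partial>M) = osc_int M f U T"
    unfolding K_def osc_int_def by (rule P.Fubini') measurable
  finally show ?thesis .
qed

lemma (in sigma_finite_measure) osc_int_commute:
  assumes f[measurable]: "f \<in> borel_measurable M"
    and [measurable]: "S \<in> sets M" "T \<in> sets M"
  shows "osc_int M f S T = osc_int M f T S"
proof -
  interpret P: pair_sigma_finite M M ..
  have "osc_int M f S T = (\<integral>\<^sup>+x. \<integral>\<^sup>+y. indicator S y * indicator T x * ennreal ((f y - f x)\<^sup>2) \<partial>M \<partial>M)"
    unfolding osc_int_def by (rule P.Fubini'[symmetric]) measurable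
  also have "\<dots> = osc_int M f T S"
    unfolding osc_int_def
    by (intro nn_integral_cong) (simp add: power2_commute mult.commute mult.left_commute)
  finally show ?thesis .
qed

lemma open_emeasure_lebesgue_on_pos:
  fixes \<Omega> :: "'a::euclidean_space set"
  assumes "open \<Omega>" "open V" "\<Omega> \<inter> V \<noteq> {}"
  shows "emeasure (lebesgue_on \<Omega>) (\<Omega> \<inter> V) \<noteq> 0"
proof -
  have "open (\<Omega> \<inter> V)" using assms by auto
  then have "\<not> negligible (\<Omega> \<inter> V)"
    using assms(3) open_not_negligible by blast
  moreover have "emeasure (lebesgue_on \<Omega>) (\<Omega> \<inter> V) = emeasure lebesgue (\<Omega> \<inter> V)"
    using assms by (intro emeasure_restrict_space) auto
  ultimately show ?thesis
    using \<open>open (\<Omega> \<inter> V)\<close> by (auto simp: negligible_iff_null_sets null_sets_def)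
qed

lemma finite_measure_lebesgue_on_bounded_open:
  assumes "open \<Omega>" "bounded \<Omega>"
  shows "finite_measure (lebesgue_on \<Omega>)"
proof (rule finite_measure_lebesgue_on)
  show "\<Omega> \<in> lmeasurable" using assms lmeasurable_open by blast
qed

text \<open>
  The constant depends on the centres but not on \<open>f\<close>. The bound is an equivalence relation
  between \<open>a\<close> and \<open>b\<close>, so only close centres have to be treated, by connectedness of \<open>\<Omega>\<close>. Transitivity divides
  by the measure of the middle ball, which is positive because \<open>\<Omega>\<close> is open.
\<close>
lemma osc_int_ball_pair:
  fixes \<Omega> :: "'a::euclidean_space set"
  assumes \<Omega>: "open \<Omega>" "connected \<Omega>" "bounded \<Omega>" and r: "r > 0" and ab: "a \<in> \<Omega>" "b \<in> \<Omega>"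
  shows "\<exists>C<top. \<forall>f\<in>borel_measurable (lebesgue_on \<Omega>).
           osc_int (lebesgue_on \<Omega>) f (\<Omega> \<inter> ball a (r / 3)) (\<Omega> \<inter> ball b (r / 3))
           \<le> C * near_osc_int (lebesgue_on \<Omega>) r f"
    (is "?R a b")
proof -
  let ?M = "lebesgue_on \<Omega>"
  let ?B = "\<lambda>x. \<Omega> \<inter> ball x (r / 3)"
  interpret finite_measure ?M
    using \<Omega> by (intro finite_measure_lebesgue_on_bounded_open)
  have Bset[measurable]: "?B x \<in> sets ?M" for x
    using \<Omega> by (auto simp: sets_restrict_space_iff)
  have mfin: "emeasure ?M S < top" for S
    using emeasure_finite[of S] by (simp add: less_top[symmetric])
  show ?thesis
  proof (rule connected_equivalence_relation[OF \<Omega>(2) ab, of ?R])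
    show "?R y x" if "?R x y" for x y
      using that by (metis osc_int_commute Bset)
  next
    fix x y z assume R: "?R x y" "?R y z" and "y \<in> \<Omega>"
    obtain C where C: "C < top" "\<And>f. f \<in> borel_measurable ?M \<Longrightarrow> osc_int ?M f (?B x) (?B y) \<le> C * near_osc_int ?M r f"
      using R(1) by blast
    obtain C' where C': "C' < top" "\<And>f. f \<in> borel_measurable ?M \<Longrightarrow> osc_int ?M f (?B y) (?B z) \<le> C' * near_osc_int ?M r f"
      using R(2) by blast
    let ?m = "\<lambda>x. emeasure ?M (?B x)"
    have m0: "?m y \<noteq> 0"
      using open_emeasure_lebesgue_on_pos[of \<Omega> "ball y (r/3)"] \<Omega> \<open>y \<in> \<Omega>\<close> r
      by (metis open_ball IntI centre_in_ball divide_pos_pos empty_iff zero_less_numeral)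
    define D where "D = inverse (?m y) * (2 * ?m z * C + 2 * ?m x * C')"
    have "D < top"
      unfolding D_def using C(1) C'(1) m0 mfin
      by (auto simp: ennreal_mult_less_top ennreal_inverse_top less_top[symmetric] ennreal_inverse_eq_top_iff  ennreal_mult_eq_top_iff)
    moreover have "osc_int ?M f (?B x) (?B z) \<le> D * near_osc_int ?M r f" if f: "f \<in> borel_measurable ?M" for f
    proof -
      have "osc_int ?M f (?B x) (?B z) = inverse (?m y) * ?m y * osc_int ?M f (?B x) (?B z)"
        using ennreal_inverse_mult[of "?m y"] m0 mfin[of "?B y"] by (simp add: mult.commute divide_ennreal_def[symmetric] ennreal_divide_self)
      also have "\<dots> \<le> inverse (?m y) * (2 * ?m z * osc_int ?M f (?B x) (?B y) + 2 * ?m x * osc_int ?M f (?B y) (?B z))"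
        unfolding mult.assoc using osc_int_triangle[OF f Bset Bset Bset, of y x z]
        by (intro mult_left_mono) (auto simp: mult.assoc)
      also have "\<dots> \<le> inverse (?m y) * (2 * ?m z * (C * near_osc_int ?M r f) + 2 * ?m x * (C' * near_osc_int ?M r f))"
        using C(2)[OF f] C'(2)[OF f] by (intro mult_left_mono add_mono) auto
      also have "\<dots> = D * near_osc_int ?M r f"
        by (simp add: D_def algebra_simps)
      finally show ?thesis .
    qed
    ultimately show "?R x z" by blast
  next
    \<comment> \<open>Points of two balls of radius \<open>r / 3\<close> whose centres are closer than \<open>r / 3\<close> are closer than \<open>r\<close>.\<close>
    fix x assume "x \<in> \<Omega>"
    show "\<exists>T. openin (top_of_set \<Omega>) T \<and> x \<in> T \<and> (\<forall>y\<in>T. ?R x y)"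
    proof (intro exI[of _ "?B x"] conjI ballI)
      show "openin (top_of_set \<Omega>) (?B x)" by (simp add: openin_open_Int)
      show "x \<in> ?B x" using \<open>x \<in> \<Omega>\<close> r by simp
      fix y assume y: "y \<in> ?B x"
      have "osc_int ?M f (?B x) (?B y) \<le> 1 * near_osc_int ?M r f" for f
        unfolding osc_int_def near_osc_int_def mult_1
      proof (intro nn_integral_mono mult_right_mono)
        fix u v
        have "dist u v < r" if "dist x u < r/3" "dist y v < r/3"
        proof -
          have "dist u v \<le> dist u x + dist x v" "dist x v \<le> dist x y + dist y v"
            by (rule dist_triangle)+
          then show ?thesis using that y by (simp add: dist_commute)
        qed
        then show "indicator (?B x) u * indicator (?B y) v
             \<le> (indicator {p. dist (fst p) (snd p) < r} (u, v) :: ennreal)"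
          by (auto simp: indicator_def)
      qed auto
      then show "?R x y" by (intro exI[of _ 1]) auto
    qed
  qed
qed

text \<open>
  A Poincare inequality on a bounded, connected open set: short-range differences control
  all differences. Covering \<open>closure \<Omega>\<close> by balls centred in \<open>\<Omega>\<close> itself makes \<open>osc_int_ball_pair\<close>
  applicable to every pair of balls.
\<close>
lemma near_osc_int_controls_osc_int:
  fixes \<Omega> :: "'a::euclidean_space set"
  assumes \<Omega>: "open \<Omega>" "connected \<Omega>" "bounded \<Omega>" and r: "r > 0"
  shows "\<exists>C<top. \<forall>f\<in>borel_measurable (lebesgue_on \<Omega>).
           osc_int (lebesgue_on \<Omega>) f \<Omega> \<Omega> \<le> C * near_osc_int (lebesgue_on \<Omega>) r f"
proof -
  let ?M = "lebesgue_on \<Omega>"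
  let ?B = "\<lambda>x. \<Omega> \<inter> ball x (r / 3)"
  interpret finite_measure ?M
    using \<Omega> by (intro finite_measure_lebesgue_on_bounded_open)
  have Bset[measurable]: "?B x \<in> sets ?M" for x
    using \<Omega> by (auto simp: sets_restrict_space_iff)
  have "compact (closure \<Omega>)" using \<Omega> by simp
  moreover have "closure \<Omega> \<subseteq> (\<Union>x\<in>\<Omega>. ball x (r/3))"
  proof
    fix x assume "x \<in> closure \<Omega>"
    then obtain y where "y \<in> \<Omega>" "dist y x < r/3"
      using r unfolding closure_approachable by (meson divide_pos_pos zero_less_numeral)
    then show "x \<in> (\<Union>x\<in>\<Omega>. ball x (r/3))" by auto
  qed
  ultimately obtain F where F: "F \<subseteq> \<Omega>" "finite F" "closure \<Omega> \<subseteq> (\<Union>x\<in>F. ball x (r/3))"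
    by (metis (no_types, lifting) compactE_image open_ball)
  obtain c where c: "\<And>a b. a \<in> \<Omega> \<Longrightarrow> b \<in> \<Omega> \<Longrightarrow> c a b < top \<and> (\<forall>f\<in>borel_measurable ?M.
      osc_int ?M f (?B a) (?B b) \<le> c a b * near_osc_int ?M r f)"
    using osc_int_ball_pair[OF \<Omega> r] by metis
  show ?thesis
  proof (intro exI[of _ "\<Sum>a\<in>F. \<Sum>b\<in>F. c a b"] conjI ballI)
    show "(\<Sum>a\<in>F. \<Sum>b\<in>F. c a b) < top"
      using c F(1) by (auto intro!: iffD2[OF ennreal_sum_less_top] F(2) simp: less_top subset_iff)
    fix f :: "'a \<Rightarrow> real" assume f[measurable]: "f \<in> borel_measurable ?M"
    have cover: "indicator \<Omega> x * indicator \<Omega> y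
         \<le> (\<Sum>a\<in>F. \<Sum>b\<in>F. indicator (?B a) x * indicator (?B b) y :: ennreal)" for x y
    proof (cases "x \<in> \<Omega> \<and> y \<in> \<Omega>")
      case True
      then obtain a b where ab: "a \<in> F" "b \<in> F" "x \<in> ?B a" "y \<in> ?B b"
        using F(3) closure_subset[of \<Omega>] by blast
      have "(1::ennreal) = indicator (?B a) x * indicator (?B b) y" using ab by simp
      also have "\<dots> \<le> (\<Sum>b\<in>F. indicator (?B a) x * indicator (?B b) y)"
        by (rule member_le_sum) (use ab F in auto)
      also have "\<dots> \<le> (\<Sum>a\<in>F. \<Sum>b\<in>F. indicator (?B a) x * indicator (?B b) y)"
        by (rule member_le_sum[of a]) (use ab F in auto)
      finally show ?thesis using True by simp
    qed auto
    have "osc_int ?M f \<Omega> \<Omega>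
        \<le> (\<integral>\<^sup>+x. \<integral>\<^sup>+y. (\<Sum>a\<in>F. \<Sum>b\<in>F. indicator (?B a) x * indicator (?B b) y) * ennreal ((f x - f y)\<^sup>2) \<partial>?M \<partial>?M)"
      unfolding osc_int_def by (intro nn_integral_mono mult_right_mono cover) auto
    also have "\<dots> = (\<Sum>a\<in>F. \<Sum>b\<in>F. osc_int ?M f (?B a) (?B b))"
      unfolding osc_int_def by (simp add: sum_distrib_right nn_integral_sum)
    also have "\<dots> \<le> (\<Sum>a\<in>F. \<Sum>b\<in>F. c a b * near_osc_int ?M r f)"
      using c F(1) f by (intro sum_mono) blast
    also have "\<dots> = (\<Sum>a\<in>F. \<Sum>b\<in>F. c a b) * near_osc_int ?M r f"
      by (simp add: sum_distrib_right)
    finally show "osc_int ?M f \<Omega> \<Omega> \<le> (\<Sum>a\<in>F. \<Sum>b\<in>F. c a b) * near_osc_int ?M r f" .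
  qed
qed

lemma ident_measurable_lebesgue_on_borel: "(\<lambda>x. x) \<in> measurable (lebesgue_on S) borel"
proof -
  have "(\<lambda>x. x) \<in> measurable lborel (borel :: 'a measure)" by simp
  then show ?thesis by (intro measurable_restrict_space1 measurable_completion)
qed

lemma near_osc_int_product:
  fixes \<Omega> :: "'a::euclidean_space set" and r :: real
  assumes \<Omega>: "open \<Omega>" "bounded \<Omega>" and f[measurable]: "f \<in> borel_measurable (lebesgue_on \<Omega>)"
  defines "q \<equiv> \<lambda>p. indicator {p. dist (fst p) (snd p) < r} p * ennreal ((f (fst p) - f (snd p))\<^sup>2)"
  shows "q \<in> borel_measurable (lebesgue_on \<Omega> \<Otimes>\<^sub>M lebesgue_on \<Omega>)"
    and "near_osc_int (lebesgue_on \<Omega>) r f = integral\<^sup>N (lebesgue_on \<Omega> \<Otimes>\<^sub>M lebesgue_on \<Omega>) q"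
proof -
  let ?M = "lebesgue_on \<Omega>"
  interpret finite_measure ?M
    using \<Omega> by (intro finite_measure_lebesgue_on_bounded_open)
  note id = ident_measurable_lebesgue_on_borel[of \<Omega>]
  have [measurable]: "(\<lambda>p. dist (fst p) (snd p)) \<in> borel_measurable (?M \<Otimes>\<^sub>M ?M)"
    by (rule borel_measurable_dist)
      (rule measurable_compose[OF measurable_fst id], rule measurable_compose[OF measurable_snd id])
  have "q = (\<lambda>p. if dist (fst p) (snd p) < r then ennreal ((f (fst p) - f (snd p))\<^sup>2) else 0)"
    by (auto simp: q_def fun_eq_iff)
  also have "\<dots> \<in> borel_measurable (?M \<Otimes>\<^sub>M ?M)" by measurable
  finally show q: "q \<in> borel_measurable (?M \<Otimes>\<^sub>M ?M)" .
  show "near_osc_int ?M r f = integral\<^sup>N (?M \<Otimes>\<^sub>M ?M) q"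
    using nn_integral_fst[OF q] by (simp add: near_osc_int_def q_def)
qed

section \<open>The energy identity for bounded symmetric jump kernels\<close>

lemma square_integrable_imp_integrable_mult:
  fixes f g :: "'b \<Rightarrow> real"
  assumes [measurable]: "f \<in> borel_measurable M" "g \<in> borel_measurable M"
    and "integrable M (\<lambda>x. (f x)\<^sup>2)" "integrable M (\<lambda>x. (g x)\<^sup>2)"
  shows "integrable M (\<lambda>x. f x * g x)"
proof (rule Bochner_Integration.integrable_bound)
  show "integrable M (\<lambda>x. (f x)\<^sup>2 + (g x)\<^sup>2)" using assms by simp
  have "\<bar>a * b\<bar> \<le> a\<^sup>2 + b\<^sup>2" for a b :: real
  proof -
    have "2 * (\<bar>a\<bar> * \<bar>b\<bar>) \<le> a\<^sup>2 + b\<^sup>2"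
      using sum_squares_bound[of "\<bar>a\<bar>" "\<bar>b\<bar>"] by simp
    moreover have "0 \<le> \<bar>a\<bar> * \<bar>b\<bar>" by simp
    ultimately show ?thesis unfolding abs_mult by argo
  qed
  then show "AE x in M. norm (f x * g x) \<le> norm ((f x)\<^sup>2 + (g x)\<^sup>2)"
    by (intro AE_I2) (smt (verit) real_norm_def)
qed measurable

lemma (in finite_measure) square_integrable_imp_integrable:
  fixes f :: "'a \<Rightarrow> real"
  assumes "f \<in> borel_measurable M" "integrable M (\<lambda>x. (f x)\<^sup>2)"
  shows "integrable M f"
  using square_integrable_imp_integrable_mult[of f M "\<lambda>_. 1"] assms by simp

locale bounded_symmetric_kernel = finite_measure M for M :: "'b measure" +
  fixes k :: "'b \<Rightarrow> 'b \<Rightarrow> real" and c :: real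
  assumes k_measurable[measurable]: "(\<lambda>(x, y). k x y) \<in> borel_measurable (M \<Otimes>\<^sub>M M)"
    and k_sym: "\<And>x y. x \<in> space M \<Longrightarrow> y \<in> space M \<Longrightarrow> k x y = k y x"
    and k_bound: "\<And>x y. x \<in> space M \<Longrightarrow> y \<in> space M \<Longrightarrow> \<bar>k x y\<bar> \<le> c"
begin

sublocale P: pair_sigma_finite M M ..

definition jump_op :: "('b \<Rightarrow> real) \<Rightarrow> 'b \<Rightarrow> real" where
  "jump_op f x = (LINT y|M. k x y * (f y - f x))"

definition dirichlet_form :: "('b \<Rightarrow> real) \<Rightarrow> real" where
  "dirichlet_form f = (LINT p|(M \<Otimes>\<^sub>M M). k (fst p) (snd p) * (f (fst p) - f (snd p))\<^sup>2)"

lemma k_measurable'[measurable]: "(\<lambda>p. k (fst p) (snd p)) \<in> borel_measurable (M \<Otimes>\<^sub>M M)"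
  using k_measurable by (simp add: case_prod_beta')

lemma integrable_fst_factor:
  fixes h :: "'b \<Rightarrow> real"
  assumes h: "integrable M h"
  shows "integrable (M \<Otimes>\<^sub>M M) (\<lambda>p. h (fst p))"
proof (rule P.Fubini_integrable)
  note [measurable] = borel_measurable_integrable[OF h]
  show "(\<lambda>p. h (fst p)) \<in> borel_measurable (M \<Otimes>\<^sub>M M)" by measurable
  show "integrable M (\<lambda>x. LINT y|M. norm (h (fst (x, y))))" using h by simp
  show "AE x in M. integrable M (\<lambda>y. h (fst (x, y)))" by simp
qed

lemma integrable_snd_factor:
  fixes h :: "'b \<Rightarrow> real"
  assumes h: "integrable M h"
  shows "integrable (M \<Otimes>\<^sub>M M) (\<lambda>p. h (snd p))"
  using P.integrable_product_swap[OF integrable_fst_factor[OF h]] by (simp add: case_prod_beta')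

text \<open>
  Supplies the integrability that Fubini requires of the kernel integrals: since \<open>k\<close> is bounded, a majorant
  of \<open>g\<close> suffices.
\<close>
lemma integrable_kernel_bound:
  assumes [measurable]: "g \<in> borel_measurable (M \<Otimes>\<^sub>M M)"
    and G: "integrable (M \<Otimes>\<^sub>M M) G" "\<And>p. \<bar>g p\<bar> \<le> (G p::real)"
  shows "integrable (M \<Otimes>\<^sub>M M) (\<lambda>p. k (fst p) (snd p) * g p)"
proof (rule Bochner_Integration.integrable_bound)
  show "integrable (M \<Otimes>\<^sub>M M) (\<lambda>p. c * G p)" using G by simp
  show "AE p in M \<Otimes>\<^sub>M M. norm (k (fst p) (snd p) * g p) \<le> norm (c * G p)"
  proof (rule AE_I2)
    fix p assume "p \<in> space (M \<Otimes>\<^sub>M M)"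
    then have "\<bar>k (fst p) (snd p)\<bar> \<le> c" by (auto simp: space_pair_measure intro: k_bound)
    then have "\<bar>k (fst p) (snd p)\<bar> * \<bar>g p\<bar> \<le> c * G p"
      using G(2)[of p] by (intro mult_mono) auto
    then show "norm (k (fst p) (snd p) * g p) \<le> norm (c * G p)"
      unfolding real_norm_def abs_mult[of "k _ _"] by (rule order_trans[OF _ abs_ge_self])
  qed
qed measurable

lemma integral_swap_kernel:
  assumes [measurable]: "g \<in> borel_measurable (M \<Otimes>\<^sub>M M)"
  shows "(LINT p|(M \<Otimes>\<^sub>M M). k (fst p) (snd p) * (g (snd p, fst p) :: real))
       = (LINT p|(M \<Otimes>\<^sub>M M). k (fst p) (snd p) * g p)"
proof -
  have "(LINT p|(M \<Otimes>\<^sub>M M). k (fst p) (snd p) * g p)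
      = (LINT p|(M \<Otimes>\<^sub>M M). k (snd p) (fst p) * g (snd p, fst p))"
    using P.integral_product_swap[of "\<lambda>p. k (fst p) (snd p) * g p"] by (simp add: case_prod_beta')
  also have "\<dots> = (LINT p|(M \<Otimes>\<^sub>M M). k (fst p) (snd p) * g (snd p, fst p))"
    by (intro Bochner_Integration.integral_cong) (auto simp: space_pair_measure k_sym)
  finally show ?thesis ..
qed

context
  fixes f :: "'b \<Rightarrow> real"
  assumes f[measurable]: "f \<in> borel_measurable M" and f2: "integrable M (\<lambda>x. (f x)\<^sup>2)"
begin

lemma integrable_f: "integrable M f"
  using square_integrable_imp_integrable f f2 by blast

lemma integrable_sq_sum:
  "integrable (M \<Otimes>\<^sub>M M) (\<lambda>p. 2 * (f (fst p))\<^sup>2 + 2 * (f (snd p))\<^sup>2)"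
  using integrable_fst_factor[OF f2] integrable_snd_factor[OF f2] by simp

lemma integrable_dirichlet:
  "integrable (M \<Otimes>\<^sub>M M) (\<lambda>p. k (fst p) (snd p) * (f (fst p) - f (snd p))\<^sup>2)"
  by (rule integrable_kernel_bound[OF _ integrable_sq_sum]) (auto simp: sq_diff_bound)

text \<open>
  By symmetry of \<open>k\<close> the integrand \<open>k x y * (f y - f x)\<close> changes sign when \<open>x\<close> and \<open>y\<close> are exchanged.
\<close>
lemma integral_jump_op: "(LINT x|M. jump_op f x) = 0"
proof -
  let ?g = "\<lambda>p. f (snd p) - f (fst p)"
  have int: "integrable (M \<Otimes>\<^sub>M M) (\<lambda>p. k (fst p) (snd p) * ?g p)"
    by (rule integrable_kernel_bound[where G = "\<lambda>p. \<bar>f (snd p)\<bar> + \<bar>f (fst p)\<bar>"])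
      (use integrable_fst_factor[OF integrable_f] integrable_snd_factor[OF integrable_f] in auto)
  have "(LINT x|M. jump_op f x) = (LINT p|(M \<Otimes>\<^sub>M M). k (fst p) (snd p) * ?g p)"
    unfolding jump_op_def using P.integral_fst'[OF int] by simp
  moreover have "(LINT p|(M \<Otimes>\<^sub>M M). k (fst p) (snd p) * ?g p)
      = (LINT p|(M \<Otimes>\<^sub>M M). k (fst p) (snd p) * ?g (snd p, fst p))"
    by (rule integral_swap_kernel[symmetric]) measurable
  moreover have "\<dots> = (LINT p|(M \<Otimes>\<^sub>M M). - (k (fst p) (snd p) * ?g p))"
    by (rule Bochner_Integration.integral_cong) (simp_all add: algebra_simps)
  ultimately show ?thesis by simp
qed

text \<open>
  The average of the double integrals of \<open>k x y * f x * (f y - f x)\<close> and of its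
  transpose is minus half the Dirichlet form.
\<close>
lemma integral_mult_jump_op: "(LINT x|M. f x * jump_op f x) = - dirichlet_form f / 2"
proof -
  let ?g = "\<lambda>p. f (fst p) * (f (snd p) - f (fst p))"
  have bd: "\<bar>a * (b - a)\<bar> \<le> 2 * (2 * a\<^sup>2 + 2 * b\<^sup>2)" for a b :: real
  proof -
    have "2 * \<bar>a * (b - a)\<bar> \<le> a\<^sup>2 + (b - a)\<^sup>2"
      using sum_squares_bound[of "\<bar>a\<bar>" "\<bar>b - a\<bar>"] by (simp add: abs_mult)
    moreover have "0 \<le> a\<^sup>2" "0 \<le> b\<^sup>2" by auto
    ultimately show ?thesis using sq_diff_bound[of b a] by argo
  qed
  have int: "integrable (M \<Otimes>\<^sub>M M) (\<lambda>p. k (fst p) (snd p) * ?g p)"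
    by (rule integrable_kernel_bound[OF _ integrable_mult_right[OF integrable_sq_sum] bd]) measurable
  have "(LINT x|M. f x * jump_op f x) = (LINT x|M. LINT y|M. k x y * (f x * (f y - f x)))"
    unfolding jump_op_def
    by (subst integral_mult_right_zero[symmetric]) (simp add: mult_ac)
  also have "\<dots> = (LINT p|(M \<Otimes>\<^sub>M M). k (fst p) (snd p) * ?g p)"
    using P.integral_fst'[OF int] by simp
  finally have eq: "(LINT x|M. f x * jump_op f x) = (LINT p|(M \<Otimes>\<^sub>M M). k (fst p) (snd p) * ?g p)" .
  have "(LINT p|(M \<Otimes>\<^sub>M M). k (fst p) (snd p) * ?g (snd p, fst p))
      = (LINT p|(M \<Otimes>\<^sub>M M). - (k (fst p) (snd p) * (f (fst p) - f (snd p))\<^sup>2) - k (fst p) (snd p) * ?g p)"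
    by (intro Bochner_Integration.integral_cong) (auto simp: power2_eq_square algebra_simps)
  also have "\<dots> = - dirichlet_form f - (LINT p|(M \<Otimes>\<^sub>M M). k (fst p) (snd p) * ?g p)"
    unfolding dirichlet_form_def using int integrable_dirichlet by simp
  finally show ?thesis
    using integral_swap_kernel[of ?g] eq by simp
qed

lemma jump_op_measurable[measurable]: "jump_op f \<in> borel_measurable M"
  unfolding jump_op_def by measurable

lemma jump_integrand_bound:
  assumes "x \<in> space M" "y \<in> space M"
  shows "\<bar>k x y * (f y - f x)\<bar> \<le> c * (\<bar>f y\<bar> + \<bar>f x\<bar>)"
  unfolding abs_mult using k_bound[OF assms] by (intro mult_mono) auto

lemma integrable_jump:
  assumes x: "x \<in> space M"
  shows "integrable M (\<lambda>y. k x y * (f y - f x))"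
proof (rule Bochner_Integration.integrable_bound)
  have [measurable]: "(\<lambda>y. k x y) \<in> borel_measurable M"
    using measurable_Pair2[OF k_measurable x] by simp
  show "(\<lambda>y. k x y * (f y - f x)) \<in> borel_measurable M" by measurable
  show "integrable M (\<lambda>y. c * (\<bar>f y\<bar> + \<bar>f x\<bar>))"
    using integrable_f by simp
  show "AE y in M. norm (k x y * (f y - f x)) \<le> norm (c * (\<bar>f y\<bar> + \<bar>f x\<bar>))"
    unfolding real_norm_def by (intro AE_I2 order_trans[OF jump_integrand_bound[OF x] abs_ge_self])
qed

lemma jump_op_bound:
  assumes x: "x \<in> space M"
  shows "\<bar>jump_op f x\<bar> \<le> c * ((LINT y|M. \<bar>f y\<bar>) + measure M (space M) * \<bar>f x\<bar>)"
proof -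
  have "\<bar>jump_op f x\<bar> \<le> (LINT y|M. \<bar>k x y * (f y - f x)\<bar>)"
    unfolding jump_op_def by (rule integral_abs_bound)
  also have "\<dots> \<le> (LINT y|M. c * (\<bar>f y\<bar> + \<bar>f x\<bar>))"
    using integrable_jump[OF x] integrable_f jump_integrand_bound[OF x] by (intro integral_mono) auto
  also have "\<dots> = c * ((LINT y|M. \<bar>f y\<bar>) + measure M (space M) * \<bar>f x\<bar>)"
    using integrable_f by simp
  finally show ?thesis .
qed

lemma jump_op_square_integrable: "integrable M (\<lambda>x. (jump_op f x)\<^sup>2)"
proof (rule Bochner_Integration.integrable_bound)
  let ?a = "LINT y|M. \<bar>f y\<bar>" and ?b = "measure M (space M)"
  show "integrable M (\<lambda>x. (c * (?a + ?b * \<bar>f x\<bar>))\<^sup>2)"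
    using integrable_f f2 by (simp add: power_mult_distrib power2_sum)
  show "AE x in M. norm ((jump_op f x)\<^sup>2) \<le> norm ((c * (?a + ?b * \<bar>f x\<bar>))\<^sup>2)"
  proof (intro AE_I2)
    fix x assume "x \<in> space M"
    then have "\<bar>jump_op f x\<bar> \<le> \<bar>c * (?a + ?b * \<bar>f x\<bar>)\<bar>"
      by (rule order_trans[OF jump_op_bound abs_ge_self])
    then show "norm ((jump_op f x)\<^sup>2) \<le> norm ((c * (?a + ?b * \<bar>f x\<bar>))\<^sup>2)"
      by (simp only: abs_le_square_iff real_norm_def abs_power2)
  qed
qed measurable

lemma sq_osc_integrable: "integrable (M \<Otimes>\<^sub>M M) (\<lambda>p. (f (fst p) - f (snd p))\<^sup>2)"
proof (rule Bochner_Integration.integrable_bound[OF integrable_sq_sum])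
  show "AE p in M \<Otimes>\<^sub>M M. norm ((f (fst p) - f (snd p))\<^sup>2)
      \<le> norm (2 * (f (fst p))\<^sup>2 + 2 * (f (snd p))\<^sup>2)"
    unfolding real_norm_def abs_power2
    by (intro AE_I2 order_trans[OF sq_diff_bound abs_ge_self])
qed measurable

text \<open>
  Up to normalisation by the total mass, this says that the mean square difference of two
  independent copies of a random variable is twice its variance.
\<close>
lemma sq_osc_integral:
  assumes "(LINT x|M. f x) = 0"
  shows "(LINT p|(M \<Otimes>\<^sub>M M). (f (fst p) - f (snd p))\<^sup>2) = 2 * measure M (space M) * (LINT x|M. (f x)\<^sup>2)"
proof -
  have "(LINT p|(M \<Otimes>\<^sub>M M). (f (fst p) - f (snd p))\<^sup>2) = (LINT x|M. LINT y|M. (f x - f y)\<^sup>2)"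
    using P.integral_fst'[OF sq_osc_integrable] by simp
  also have "\<dots> = (LINT x|M. measure M (space M) * (f x)\<^sup>2 + (LINT y|M. (f y)\<^sup>2))"
    using assms integrable_f f2 by (simp add: power2_diff)
  also have "\<dots> = 2 * measure M (space M) * (LINT x|M. (f x)\<^sup>2)"
    using f2 by simp
  finally show ?thesis .
qed

end

end

section \<open>Calculus of curves in \<open>L\<^sup>2\<close>\<close>

definition L2_inner :: "'a::euclidean_space set \<Rightarrow> ('a \<Rightarrow> real) \<Rightarrow> ('a \<Rightarrow> real) \<Rightarrow> real" where
  "L2_inner \<Omega> f g = (LINT x|lebesgue_on \<Omega>. f x * g x)"

lemma in_L2_integrable_mult:
  "in_L2 \<Omega> f \<Longrightarrow> in_L2 \<Omega> g \<Longrightarrow> integrable (lebesgue_on \<Omega>) (\<lambda>x. f x * g x)"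
  unfolding in_L2_def by (intro square_integrable_imp_integrable_mult) auto

lemma in_L2_add: "in_L2 \<Omega> f \<Longrightarrow> in_L2 \<Omega> g \<Longrightarrow> in_L2 \<Omega> (\<lambda>x. f x + g x)"
  using in_L2_integrable_mult[of \<Omega> f g]
  by (auto simp: in_L2_def power2_sum mult.assoc)

lemma in_L2_cmult: "in_L2 \<Omega> f \<Longrightarrow> in_L2 \<Omega> (\<lambda>x. c * f x)"
  by (auto simp: in_L2_def power_mult_distrib)

lemma in_L2_diff: "in_L2 \<Omega> f \<Longrightarrow> in_L2 \<Omega> g \<Longrightarrow> in_L2 \<Omega> (\<lambda>x. f x - g x)"
  using in_L2_add[of \<Omega> f "\<lambda>x. -1 * g x"] in_L2_cmult[of \<Omega> g "-1"] by simp

lemma in_L2_divide: "in_L2 \<Omega> f \<Longrightarrow> in_L2 \<Omega> (\<lambda>x. f x / c)"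
  using in_L2_cmult[of \<Omega> f "1 / c"] by simp

lemma L2_norm_power2: "(L2_norm \<Omega> f)\<^sup>2 = L2_inner \<Omega> f f"
  by (simp add: L2_norm_def L2_inner_def power2_eq_square)

lemma L2_inner_commute: "L2_inner \<Omega> f g = L2_inner \<Omega> g f"
  by (simp add: L2_inner_def mult.commute)

lemma L2_inner_diff_left:
  assumes "in_L2 \<Omega> f" "in_L2 \<Omega> g" "in_L2 \<Omega> h"
  shows "L2_inner \<Omega> (\<lambda>x. f x - g x) h = L2_inner \<Omega> f h - L2_inner \<Omega> g h"
  using in_L2_integrable_mult[OF assms(1,3)] in_L2_integrable_mult[OF assms(2,3)]
  by (simp add: L2_inner_def left_diff_distrib)

lemma L2_inner_diff_right:
  assumes "in_L2 \<Omega> f" "in_L2 \<Omega> g" "in_L2 \<Omega> h"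
  shows "L2_inner \<Omega> h (\<lambda>x. f x - g x) = L2_inner \<Omega> h f - L2_inner \<Omega> h g"
  using L2_inner_diff_left[OF assms] by (simp add: L2_inner_commute)

lemma L2_inner_divide_left: "L2_inner \<Omega> (\<lambda>x. f x / c) h = L2_inner \<Omega> f h / c"
  by (simp add: L2_inner_def)

lemma L2_inner_quotient_left:
  assumes "in_L2 \<Omega> f" "in_L2 \<Omega> g" "in_L2 \<Omega> h" "in_L2 \<Omega> z"
  shows "L2_inner \<Omega> (\<lambda>x. (f x - g x) / c - h x) z = (L2_inner \<Omega> f z - L2_inner \<Omega> g z) / c - L2_inner \<Omega> h z"
  using L2_inner_diff_left[OF in_L2_divide[OF in_L2_diff[OF assms(1,2)]] assms(3,4), of c]
    L2_inner_divide_left[of \<Omega> "\<lambda>x. f x - g x" c z] L2_inner_diff_left[OF assms(1,2,4)] by simp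

text \<open>
  The quadratic form \<open>(s, t) \<mapsto> \<parallel>s f - t g\<parallel>\<^sup>2\<close> is nonnegative. At
  \<open>s = \<parallel>g\<parallel>\<^sup>2\<close>, \<open>t = \<langle>f, g\<rangle>\<close> this is the claim multiplied by \<open>\<parallel>g\<parallel>\<^sup>2\<close>, so \<open>\<parallel>g\<parallel> = 0\<close> is treated separately.
\<close>
lemma L2_Cauchy_Schwarz:
  assumes f: "in_L2 \<Omega> f" and g: "in_L2 \<Omega> g"
  shows "\<bar>L2_inner \<Omega> f g\<bar> \<le> L2_norm \<Omega> f * L2_norm \<Omega> g"
proof -
  let ?a = "L2_inner \<Omega> f f" and ?b = "L2_inner \<Omega> g g" and ?c = "L2_inner \<Omega> f g"
  have quad: "0 \<le> s\<^sup>2 * ?a - 2 * s * t * ?c + t\<^sup>2 * ?b" for s t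
  proof -
    have "0 \<le> L2_inner \<Omega> (\<lambda>x. s * f x - t * g x) (\<lambda>x. s * f x - t * g x)"
      by (simp flip: L2_norm_power2)
    also have "\<dots> = (LINT x|lebesgue_on \<Omega>. s\<^sup>2 * (f x * f x) - 2 * s * t * (f x * g x) + t\<^sup>2 * (g x * g x))"
      unfolding L2_inner_def by (simp add: power2_eq_square algebra_simps)
    also have "\<dots> = s\<^sup>2 * ?a - 2 * s * t * ?c + t\<^sup>2 * ?b"
      unfolding L2_inner_def using in_L2_integrable_mult[OF f f] in_L2_integrable_mult[OF f g] in_L2_integrable_mult[OF g g]
      by simp
    finally show ?thesis .
  qed
  have b0: "0 \<le> ?b" by (simp flip: L2_norm_power2)
  have "?c\<^sup>2 \<le> ?a * ?b"
  proof (cases "?b = 0")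
    case False
    have "?b\<^sup>2 * ?a - 2 * ?b * ?c * ?c + ?c\<^sup>2 * ?b = ?b * (?a * ?b - ?c\<^sup>2)"
      by (simp add: power2_eq_square algebra_simps)
    then have "0 \<le> ?b * (?a * ?b - ?c\<^sup>2)" using quad[of ?b ?c] by simp
    then show ?thesis using False b0 by (simp add: zero_le_mult_iff)
  next
    case True
    have "?c = 0"
    proof (rule ccontr)
      assume "?c \<noteq> 0"
      \<comment> \<open>With \<open>\<parallel>g\<parallel> = 0\<close> the form is affine in \<open>t\<close>; this \<open>t\<close> makes it equal to \<open>-1\<close>.\<close>
      then show False using quad[of 1 "(?a + 1) / (2 * ?c)"] True by simp
    qed
    then show ?thesis using True by simp
  qed
  then have "\<bar>?c\<bar> \<le> sqrt (?a * ?b)" using real_le_rsqrt by fastforce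
  then show ?thesis
    by (simp add: L2_norm_def L2_inner_def real_sqrt_mult power2_eq_square)
qed

lemma L2_inner_tendsto:
  fixes u v :: "real \<Rightarrow> 'a::euclidean_space \<Rightarrow> real"
  assumes L2: "\<And>s. 0 \<le> s \<Longrightarrow> in_L2 \<Omega> (u s)" "\<And>s. 0 \<le> s \<Longrightarrow> in_L2 \<Omega> (v s)" and t: "0 \<le> t"
    and u: "((\<lambda>s. L2_norm \<Omega> (\<lambda>x. u s x - u t x)) \<longlongrightarrow> 0) (at t within {0..})"
    and v: "((\<lambda>s. L2_norm \<Omega> (\<lambda>x. v s x - v t x)) \<longlongrightarrow> 0) (at t within {0..})"
  shows "((\<lambda>s. L2_inner \<Omega> (u s) (v s)) \<longlongrightarrow> L2_inner \<Omega> (u t) (v t)) (at t within {0..})"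
proof -
  let ?du = "\<lambda>s x. u s x - u t x" and ?dv = "\<lambda>s x. v s x - v t x"
  let ?N = "L2_norm \<Omega>"
  have "((\<lambda>s. L2_inner \<Omega> (u s) (v s) - L2_inner \<Omega> (u t) (v t)) \<longlongrightarrow> 0) (at t within {0..})"
  proof (rule Lim_null_comparison)
    show "((\<lambda>s. ?N (?du s) * ?N (v t) + ?N (?du s) * ?N (?dv s) + ?N (u t) * ?N (?dv s)) \<longlongrightarrow> 0) (at t within {0..})"
      by (rule tendsto_eq_intros u v refl | simp)+
    show "\<forall>\<^sub>F s in at t within {0..}. norm (L2_inner \<Omega> (u s) (v s) - L2_inner \<Omega> (u t) (v t))
      \<le> ?N (?du s) * ?N (v t) + ?N (?du s) * ?N (?dv s) + ?N (u t) * ?N (?dv s)"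
      unfolding eventually_at_filter
    proof (intro always_eventually allI impI)
      fix s :: real assume "s \<in> {0..}"
      then have s: "0 \<le> s" by simp
      note in_L2_intros = L2(1)[OF s] L2(1)[OF t] L2(2)[OF s] L2(2)[OF t] in_L2_diff
      have "L2_inner \<Omega> (u s) (v s) - L2_inner \<Omega> (u t) (v t)
          = L2_inner \<Omega> (?du s) (v t) + L2_inner \<Omega> (?du s) (?dv s) + L2_inner \<Omega> (u t) (?dv s)"
        using L2_inner_diff_left[OF L2(1)[OF s] L2(1)[OF t] L2(2)[OF t]]
          L2_inner_diff_left[OF L2(1)[OF s] L2(1)[OF t] in_L2_diff[OF L2(2)[OF s] L2(2)[OF t]]]
          L2_inner_diff_right[OF L2(2)[OF s] L2(2)[OF t] L2(1)[OF s]]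
          L2_inner_diff_right[OF L2(2)[OF s] L2(2)[OF t] L2(1)[OF t]]
        by linarith
      moreover have "\<bar>L2_inner \<Omega> (?du s) (v t)\<bar> \<le> ?N (?du s) * ?N (v t)"
        "\<bar>L2_inner \<Omega> (?du s) (?dv s)\<bar> \<le> ?N (?du s) * ?N (?dv s)"
        "\<bar>L2_inner \<Omega> (u t) (?dv s)\<bar> \<le> ?N (u t) * ?N (?dv s)"
        by (intro L2_Cauchy_Schwarz in_L2_intros)+
      ultimately show "norm (L2_inner \<Omega> (u s) (v s) - L2_inner \<Omega> (u t) (v t))
        \<le> ?N (?du s) * ?N (v t) + ?N (?du s) * ?N (?dv s) + ?N (u t) * ?N (?dv s)"
        by simp
    qed
  qed
  then show ?thesis by (rule LIM_zero_cancel)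
qed

text \<open>
  The product rule for curves differentiable in \<open>L\<^sup>2\<close>. Writing the difference quotient of the inner product
  minus the claimed derivative as a sum of four inner products, each having a factor that tends
  to zero in norm, reduces it to \<open>L2_Cauchy_Schwarz\<close>.
\<close>
lemma L2_inner_has_real_derivative:
  fixes u v :: "real \<Rightarrow> 'a::euclidean_space \<Rightarrow> real"
  assumes L2: "\<And>s. 0 \<le> s \<Longrightarrow> in_L2 \<Omega> (u s)" "\<And>s. 0 \<le> s \<Longrightarrow> in_L2 \<Omega> (v s)" and t: "0 < t"
    and u': "in_L2 \<Omega> u'" "((\<lambda>h. L2_norm \<Omega> (\<lambda>x. (u (t + h) x - u t x) / h - u' x)) \<longlongrightarrow> 0) (at 0)"
    and v': "in_L2 \<Omega> v'" "((\<lambda>h. L2_norm \<Omega> (\<lambda>x. (v (t + h) x - v t x) / h - v' x)) \<longlongrightarrow> 0) (at 0)"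
    and v: "((\<lambda>h. L2_norm \<Omega> (\<lambda>x. v (t + h) x - v t x)) \<longlongrightarrow> 0) (at 0)"
  shows "((\<lambda>s. L2_inner \<Omega> (u s) (v s)) has_real_derivative
           L2_inner \<Omega> u' (v t) + L2_inner \<Omega> (u t) v') (at t)"
proof -
  let ?ru = "\<lambda>h x. (u (t + h) x - u t x) / h - u' x"
  let ?rv = "\<lambda>h x. (v (t + h) x - v t x) / h - v' x"
  let ?dv = "\<lambda>h x. v (t + h) x - v t x"
  let ?N = "L2_norm \<Omega>"
  let ?Q = "\<lambda>h. (L2_inner \<Omega> (u (t + h)) (v (t + h)) - L2_inner \<Omega> (u t) (v t)) / h"
  let ?D = "L2_inner \<Omega> u' (v t) + L2_inner \<Omega> (u t) v'"
  let ?B = "\<lambda>h. ?N (?ru h) * ?N (v t) + ?N (?ru h) * ?N (?dv h) + ?N u' * ?N (?dv h) + ?N (u t) * ?N (?rv h)"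
  have "((\<lambda>h. ?Q h - ?D) \<longlongrightarrow> 0) (at 0)"
  proof (rule Lim_null_comparison)
    show "(?B \<longlongrightarrow> 0) (at 0)"
      by (rule tendsto_eq_intros u' v' v refl | simp)+
    have "\<forall>\<^sub>F h in at (0::real). h \<noteq> 0 \<and> dist h 0 < t"
      using t unfolding eventually_at by auto
    then show "\<forall>\<^sub>F h in at 0. norm (?Q h - ?D) \<le> ?B h"
    proof (rule eventually_mono)
      fix h :: real assume h: "h \<noteq> 0 \<and> dist h 0 < t"
      then have th: "0 \<le> t + h" and t0: "0 \<le> t" by (auto simp: dist_real_def)
      note in_L2_intros = L2(1)[OF th] L2(1)[OF t0] L2(2)[OF th] L2(2)[OF t0] in_L2_diff in_L2_divide u'(1) v'(1)
      have "?Q h - ?D = L2_inner \<Omega> (?ru h) (v t) + L2_inner \<Omega> (?ru h) (?dv h)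
          + L2_inner \<Omega> u' (?dv h) + L2_inner \<Omega> (u t) (?rv h)"
      proof -
        note U = L2(1)[OF th] L2(1)[OF t0] and V = L2(2)[OF th] L2(2)[OF t0]
        have "L2_inner \<Omega> (?ru h) (v t) = (L2_inner \<Omega> (u (t + h)) (v t) - L2_inner \<Omega> (u t) (v t)) / h - L2_inner \<Omega> u' (v t)"
          by (rule L2_inner_quotient_left[OF U u'(1) V(2)])
        moreover have "L2_inner \<Omega> (?ru h) (?dv h)
            = (L2_inner \<Omega> (u (t + h)) (?dv h) - L2_inner \<Omega> (u t) (?dv h)) / h - L2_inner \<Omega> u' (?dv h)"
          by (rule L2_inner_quotient_left[OF U u'(1) in_L2_diff[OF V]])
        moreover have "L2_inner \<Omega> (u t) (?rv h)
            = (L2_inner \<Omega> (u t) (v (t + h)) - L2_inner \<Omega> (u t) (v t)) / h - L2_inner \<Omega> (u t) v'"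
          using L2_inner_quotient_left[OF V v'(1) U(2), of h] by (simp only: L2_inner_commute[of _ "u t"])
        moreover have "L2_inner \<Omega> z (?dv h) = L2_inner \<Omega> z (v (t + h)) - L2_inner \<Omega> z (v t)" if "in_L2 \<Omega> z" for z
          by (rule L2_inner_diff_right[OF V that])
        ultimately show ?thesis
          using U u'(1) by (simp add: diff_divide_distrib)
      qed
      moreover have "\<bar>L2_inner \<Omega> (?ru h) (v t)\<bar> \<le> ?N (?ru h) * ?N (v t)"
        "\<bar>L2_inner \<Omega> (?ru h) (?dv h)\<bar> \<le> ?N (?ru h) * ?N (?dv h)"
        "\<bar>L2_inner \<Omega> u' (?dv h)\<bar> \<le> ?N u' * ?N (?dv h)"
        "\<bar>L2_inner \<Omega> (u t) (?rv h)\<bar> \<le> ?N (u t) * ?N (?rv h)"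
        by (intro L2_Cauchy_Schwarz in_L2_intros)+
      ultimately show "norm (?Q h - ?D) \<le> ?B h"
        by simp
    qed
  qed
  then show ?thesis unfolding DERIV_def by (rule LIM_zero_cancel)
qed

text \<open>
  The function \<open>e t * exp (\<alpha> * t)\<close> is nonincreasing. The evolution equation holds for \<open>t > 0\<close>
  only; continuity extends the monotonicity to \<open>t = 0\<close>.
\<close>
lemma exponential_decay_of_differential_inequality:
  fixes e :: "real \<Rightarrow> real"
  assumes cont: "continuous_on {0..} e"
    and deriv: "\<And>t. 0 < t \<Longrightarrow> \<exists>d. (e has_real_derivative d) (at t) \<and> d \<le> - \<alpha> * e t"
    and t: "0 \<le> t"
  shows "e t \<le> e 0 * exp (- \<alpha> * t)"
proof -
  have "e t * exp (\<alpha> * t) \<le> e 0 * exp (\<alpha> * 0)"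
  proof (rule DERIV_nonpos_imp_decreasing_open[OF t])
    fix s :: real assume "0 < s"
    then obtain d where d: "(e has_real_derivative d) (at s)" "d \<le> - \<alpha> * e s" using deriv by blast
    have "((\<lambda>t. e t * exp (\<alpha> * t)) has_real_derivative (d + \<alpha> * e s) * exp (\<alpha> * s)) (at s)"
      by (rule derivative_eq_intros d(1) refl | simp add: algebra_simps)+
    moreover have "(d + \<alpha> * e s) * exp (\<alpha> * s) \<le> 0"
      using d(2) by (simp add: mult_nonpos_nonneg)
    ultimately show "\<exists>y. ((\<lambda>t. e t * exp (\<alpha> * t)) has_real_derivative y) (at s) \<and> y \<le> 0" by blast
  next
    show "continuous_on {0..t} (\<lambda>t. e t * exp (\<alpha> * t))"
      by (intro continuous_intros continuous_on_subset[OF cont]) auto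
  qed
  then show ?thesis by (simp add: exp_minus field_simps)
qed

section \<open>Kernels near the diagonal and the uniform spectral gap\<close>

text \<open>
  \<open>V x x\<close> attains a positive minimum on \<open>S\<close>; by uniform continuity \<open>V x y\<close> differs from \<open>V x x\<close> by less than half
  of it when \<open>y\<close> is close to \<open>x\<close>.
\<close>
lemma compact_near_diagonal_lower_bound:
  fixes V :: "'a::euclidean_space \<Rightarrow> 'a \<Rightarrow> real"
  assumes S: "compact S" and V: "admissible_kernel V"
  shows "\<exists>\<delta>>0. \<exists>r>0. \<forall>x\<in>S. \<forall>y\<in>S. dist x y < r \<longrightarrow> \<delta> \<le> V x y"
proof (cases "S = {}")
  case True
  then show ?thesis by (auto intro: exI[of _ 1])
next
  case False
  have cont: "continuous_on UNIV (\<lambda>p. V (fst p) (snd p))"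
    using V by (simp add: admissible_kernel_def case_prod_beta')
  have "continuous_on S (\<lambda>x. (x, x))" by (intro continuous_intros)
  then have "continuous_on S (\<lambda>x. V x x)"
    using continuous_on_compose2[OF cont] by fastforce
  then obtain m where m: "m \<in> S" "\<And>x. x \<in> S \<Longrightarrow> V m m \<le> V x x"
    using continuous_attains_inf[OF S False] by blast
  have pos: "0 < V m m" using V by (simp add: admissible_kernel_def)
  have "uniformly_continuous_on (S \<times> S) (\<lambda>p. V (fst p) (snd p))"
    using compact_uniformly_continuous[OF continuous_on_subset[OF cont] compact_Times[OF S S]] by simp
  then obtain r where r: "r > 0"
    "\<And>p q. p \<in> S \<times> S \<Longrightarrow> q \<in> S \<times> S \<Longrightarrow> dist q p < r \<Longrightarrow>
      dist (V (fst q) (snd q)) (V (fst p) (snd p)) < V m m / 2"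
    unfolding uniformly_continuous_on_def using pos by (metis half_gt_zero)
  have "V m m / 2 \<le> V x y" if "x \<in> S" "y \<in> S" "dist x y < r" for x y
  proof -
    have "dist (x, y) (x, x) < r" using that by (simp add: dist_Pair_Pair dist_commute)
    then have "dist (V x y) (V x x) < V m m / 2" using r(2)[of "(x, x)" "(x, y)"] that by simp
    then show ?thesis using m(2)[OF that(1)] by (simp add: dist_real_def abs_if split: if_splits)
  qed
  then show ?thesis using pos r(1) by (intro exI[of _ "V m m / 2"] conjI exI[of _ r]) auto
qed

lemma compact_kernel_bounded:
  assumes S: "compact S" and V: "admissible_kernel V"
  shows "\<exists>c. \<forall>x\<in>S. \<forall>y\<in>S. \<bar>V x y\<bar> \<le> c"
proof -
  have "continuous_on (S \<times> S) (\<lambda>(x, y). V x y)"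
    using V unfolding admissible_kernel_def by (blast intro: continuous_on_subset)
  then have "bounded ((\<lambda>(x, y). V x y) ` (S \<times> S))"
    by (intro compact_imp_bounded compact_continuous_image compact_Times S)
  then show ?thesis unfolding bounded_iff by fastforce
qed

lemma admissible_kernel_measurable:
  assumes V: "admissible_kernel V"
  shows "(\<lambda>(x, y). V x y) \<in> borel_measurable (lebesgue_on \<Omega> \<Otimes>\<^sub>M lebesgue_on \<Omega>)"
proof -
  have "(\<lambda>(x, y). V x y) \<in> borel_measurable borel"
    using V unfolding admissible_kernel_def by (intro borel_measurable_continuous_onI) auto
  then have V': "(\<lambda>(x, y). V x y) \<in> borel_measurable (borel \<Otimes>\<^sub>M borel)"
    by (simp add: borel_prod)
  have "(\<lambda>p. (fst p, snd p)) \<in> measurable (lebesgue_on \<Omega> \<Otimes>\<^sub>M lebesgue_on \<Omega>) (borel \<Otimes>\<^sub>M borel)"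
    by (intro measurable_Pair measurable_compose[OF measurable_fst ident_measurable_lebesgue_on_borel]
        measurable_compose[OF measurable_snd ident_measurable_lebesgue_on_borel])
  from measurable_compose[OF this V'] show ?thesis by simp
qed

text \<open>
  \<open>\<alpha>\<close> is chosen before \<open>k\<close>: it depends on the kernel only through \<open>\<delta>\<close> and \<open>r\<close>. This is what
  makes the decay rate uniform over all partitions.
\<close>
lemma jump_spectral_gap:
  fixes \<Omega> :: "'a::euclidean_space set"
  assumes \<Omega>: "bounded_domain \<Omega>" and \<delta>: "\<delta> > 0" and r: "r > 0"
  shows "\<exists>\<alpha>>0. \<forall>k c f.
      bounded_symmetric_kernel (lebesgue_on \<Omega>) k c \<and>
      (\<forall>x\<in>\<Omega>. \<forall>y\<in>\<Omega>. 0 \<le> k x y) \<and> (\<forall>x\<in>\<Omega>. \<forall>y\<in>\<Omega>. dist x y < r \<longrightarrow> \<delta> \<le> k x y) \<and>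
      in_L2 \<Omega> f \<and> (LINT x|lebesgue_on \<Omega>. f x) = 0 \<longrightarrow>
      \<alpha> * (L2_norm \<Omega> f)\<^sup>2 \<le> bounded_symmetric_kernel.dirichlet_form (lebesgue_on \<Omega>) k f"
proof -
  let ?M = "lebesgue_on \<Omega>"
  let ?\<mu> = "measure ?M (space ?M)"
  have \<Omega>': "open \<Omega>" "connected \<Omega>" "bounded \<Omega>" "\<Omega> \<noteq> {}"
    using \<Omega> by (auto simp: bounded_domain_def)
  then interpret finite_measure ?M by (intro finite_measure_lebesgue_on_bounded_open)
  have \<mu>: "0 < ?\<mu>"
    using open_emeasure_lebesgue_on_pos[of \<Omega> UNIV] \<Omega>'
    by (simp add: emeasure_eq_measure zero_less_measure_iff)
  obtain C where C: "C < top" "\<And>f. f \<in> borel_measurable ?M \<Longrightarrow> osc_int ?M f \<Omega> \<Omega> \<le> C * near_osc_int ?M r f"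
    using near_osc_int_controls_osc_int[OF \<Omega>'(1-3) r] by blast
  then obtain C' where C': "0 \<le> C'" "C = ennreal C'" by (cases C) auto
  show ?thesis
  \<comment> \<open>\<open>C'\<close> may be \<open>0\<close>, hence the denominator \<open>C' + 1\<close>.\<close>
  proof (intro exI[of _ "2 * \<delta> * ?\<mu> / (C' + 1)"] conjI allI impI; (elim conjE)?)
    show "0 < 2 * \<delta> * ?\<mu> / (C' + 1)" using \<delta> \<mu> C' by simp
    fix k c f
    assume k: "bounded_symmetric_kernel ?M k c" and k0: "\<forall>x\<in>\<Omega>. \<forall>y\<in>\<Omega>. 0 \<le> k x y"
      and k\<delta>: "\<forall>x\<in>\<Omega>. \<forall>y\<in>\<Omega>. dist x y < r \<longrightarrow> \<delta> \<le> k x y"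
      and f: "in_L2 \<Omega> f" and mean: "(LINT x|?M. f x) = 0"
    interpret k: bounded_symmetric_kernel ?M k c by (rule k)
    have fm[measurable]: "f \<in> borel_measurable ?M" and f2: "integrable ?M (\<lambda>x. (f x)\<^sup>2)"
      using f by (auto simp: in_L2_def)
    let ?q = "\<lambda>p. (f (fst p) - f (snd p))\<^sup>2"
    let ?D = "k.dirichlet_form f"
    have D0: "0 \<le> ?D"
      unfolding k.dirichlet_form_def using k0
      by (intro integral_nonneg_AE AE_I2) (auto simp: space_pair_measure)
    have "ennreal (2 * ?\<mu> * (L2_norm \<Omega> f)\<^sup>2) = ennreal (LINT p|(?M \<Otimes>\<^sub>M ?M). ?q p)"
      using k.sq_osc_integral[OF fm f2 mean] by (simp add: L2_norm_def)
    also have "\<dots> = (\<integral>\<^sup>+p. ennreal (?q p) \<partial>(?M \<Otimes>\<^sub>M ?M))"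
      by (intro nn_integral_eq_integral[symmetric] k.sq_osc_integrable fm f2) auto
    also have "\<dots> = (\<integral>\<^sup>+x. \<integral>\<^sup>+y. ennreal ((f x - f y)\<^sup>2) \<partial>?M \<partial>?M)"
      using nn_integral_fst[of "\<lambda>p. ennreal (?q p)" ?M] by simp
    also have "\<dots> = osc_int ?M f \<Omega> \<Omega>"
      unfolding osc_int_def by (intro nn_integral_cong) (simp add: space_restrict_space)
    also have "\<dots> \<le> C * near_osc_int ?M r f" by (rule C(2)[OF fm])
    finally have *: "ennreal (2 * ?\<mu> * (L2_norm \<Omega> f)\<^sup>2) \<le> C * near_osc_int ?M r f" .
    note near = near_osc_int_product[OF \<Omega>'(1,3) fm, of r]
    have "ennreal \<delta> * near_osc_int ?M r f
        = (\<integral>\<^sup>+p. ennreal \<delta> * (indicator {p. dist (fst p) (snd p) < r} p * ennreal (?q p)) \<partial>(?M \<Otimes>\<^sub>M ?M))"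
      unfolding near(2) by (rule nn_integral_cmult[OF near(1), symmetric])
    also have "\<dots> \<le> (\<integral>\<^sup>+p. ennreal (k (fst p) (snd p) * ?q p) \<partial>(?M \<Otimes>\<^sub>M ?M))"
    proof (intro nn_integral_mono)
      fix p assume "p \<in> space (?M \<Otimes>\<^sub>M ?M)"
      then have "fst p \<in> \<Omega>" "snd p \<in> \<Omega>" by (auto simp: space_pair_measure)
      then show "ennreal \<delta> * (indicator {p. dist (fst p) (snd p) < r} p * ennreal (?q p))
          \<le> ennreal (k (fst p) (snd p) * ?q p)"
        using k\<delta> \<delta> by (auto simp: indicator_def ennreal_mult[symmetric] intro!: ennreal_leI mult_right_mono)
    qed
    also have "\<dots> = ennreal ?D"
      unfolding k.dirichlet_form_def using k0
      by (intro nn_integral_eq_integral k.integrable_dirichlet fm f2 AE_I2) (auto simp: space_pair_measure)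
    finally have **: "ennreal \<delta> * near_osc_int ?M r f \<le> ennreal ?D" .
    have "ennreal (\<delta> * (2 * ?\<mu> * (L2_norm \<Omega> f)\<^sup>2)) \<le> ennreal \<delta> * (C * near_osc_int ?M r f)"
      using * \<delta> by (simp add: ennreal_mult mult_left_mono)
    also have "\<dots> = C * (ennreal \<delta> * near_osc_int ?M r f)" by (simp add: mult_ac)
    also have "\<dots> \<le> C * ennreal ?D" by (intro mult_left_mono **) auto
    also have "\<dots> = ennreal (C' * ?D)" using C' D0 by (simp add: ennreal_mult)
    finally have "\<delta> * (2 * ?\<mu> * (L2_norm \<Omega> f)\<^sup>2) \<le> C' * ?D"
      using C' D0 by (subst (asm) ennreal_le_iff) auto
    also have "\<dots> \<le> (C' + 1) * ?D" using D0 by (simp add: algebra_simps)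
    finally show "2 * \<delta> * ?\<mu> / (C' + 1) * (L2_norm \<Omega> f)\<^sup>2 \<le> ?D"
      using C' by (simp add: field_simps)
  qed
qed

section \<open>Decay of the jump flow\<close>

text \<open>
  Conservation of mass keeps \<open>u t - m\<close> in the space of mean-zero functions, where the spectral gap
  applies; the energy identity \<open>d/dt \<parallel>u t - m\<parallel>\<^sup>2 = - dirichlet_form (u t - m)\<close> then gives
  the decay.
\<close>
lemma jump_flow_decay:
  fixes \<Omega> :: "'a::euclidean_space set"
  assumes \<Omega>: "bounded_domain \<Omega>" and k: "bounded_symmetric_kernel (lebesgue_on \<Omega>) k c"
    and gap: "\<And>f. in_L2 \<Omega> f \<Longrightarrow> (LINT x|lebesgue_on \<Omega>. f x) = 0 \<Longrightarrow>
        \<alpha> * (L2_norm \<Omega> f)\<^sup>2 \<le> bounded_symmetric_kernel.dirichlet_form (lebesgue_on \<Omega>) k f"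
    and u: "L2_solution \<Omega> (bounded_symmetric_kernel.jump_op (lebesgue_on \<Omega>) k) u0 u"
    and u0: "(LINT x|lebesgue_on \<Omega>. u0 x) = m * measure lebesgue \<Omega>" "u0 \<in> borel_measurable (lebesgue_on \<Omega>)"
    and t: "0 \<le> t"
  shows "(L2_norm \<Omega> (\<lambda>x. u t x - m))\<^sup>2 \<le> (L2_norm \<Omega> (\<lambda>x. u0 x - m))\<^sup>2 * exp (- \<alpha> * t)"
proof -
  let ?M = "lebesgue_on \<Omega>"
  interpret k: bounded_symmetric_kernel ?M k c by (rule k)
  have \<Omega>meas: "\<Omega> \<in> sets lebesgue" using \<Omega> by (auto simp: bounded_domain_def)
  have \<mu>: "measure ?M (space ?M) = measure lebesgue \<Omega>"
    using \<Omega>meas by (simp add: space_restrict_space measure_restrict_space)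
  have const: "in_L2 \<Omega> (\<lambda>_. a)" for a by (simp add: in_L2_def)
  have uL2: "in_L2 \<Omega> (u s)" if "0 \<le> s" for s using u that by (simp add: L2_solution_def)
  have u_init: "AE x in ?M. u 0 x = u0 x" using u by (simp add: L2_solution_def)
  have u_cont: "((\<lambda>s. L2_norm \<Omega> (\<lambda>x. u s x - u t x)) \<longlongrightarrow> 0) (at t within {0..})" if "0 \<le> t" for t
    using u that by (simp add: L2_solution_def)
  have u_deriv: "((\<lambda>h. L2_norm \<Omega> (\<lambda>x. (u (t + h) x - u t x) / h - k.jump_op (u t) x)) \<longlongrightarrow> 0) (at 0)" if "0 < t" for t
    using u that by (simp add: L2_solution_def)
  have u_cont0: "((\<lambda>h. L2_norm \<Omega> (\<lambda>x. u (t + h) x - u t x)) \<longlongrightarrow> 0) (at 0)" if "0 < t" for t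
  proof -
    have "at t within {0..} = at t" using that by (intro at_within_interior) simp
    then show ?thesis using u_cont[of t] that by (simp add: LIM_offset_zero_iff)
  qed
  have jumpL2: "in_L2 \<Omega> (k.jump_op (u s))" if "0 \<le> s" for s
    using uL2[OF that] k.jump_op_square_integrable[of "u s"] k.jump_op_measurable[of "u s"]
    by (simp add: in_L2_def)
  have zero: "L2_norm \<Omega> (\<lambda>x. 0) = 0" by (simp add: L2_norm_def)
  have mass_init: "(LINT x|?M. u 0 x) = (LINT x|?M. u0 x)"
    using u_init uL2[of 0] u0 by (intro integral_cong_AE) (auto simp: in_L2_def)
  have mass: "(LINT x|?M. u s x) = m * measure lebesgue \<Omega>" if "0 \<le> s" for s
  proof (cases "s = 0")
    case True
    then show ?thesis using mass_init u0 by simp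
  next
    case False
    \<comment> \<open>Mass is the inner product with the constant curve \<open>1\<close>, so the product rule differentiates it.\<close>
    let ?F = "\<lambda>s. L2_inner \<Omega> (u s) (\<lambda>_. 1)"
    have "?F s = ?F 0"
    proof (rule DERIV_isconst_end[of 0 s ?F])
      show "0 < s" using that False by simp
      show "continuous_on {0..s} ?F"
      proof (rule continuous_on_subset)
        show "continuous_on {0..} ?F"
          unfolding continuous_on_def
          using u_cont zero by (auto intro!: L2_inner_tendsto uL2 const)
      qed auto
      fix x assume x: "0 < x" "x < s"
      have "(?F has_real_derivative L2_inner \<Omega> (k.jump_op (u x)) (\<lambda>_. 1) + L2_inner \<Omega> (u x) (\<lambda>_. 0)) (at x)"
        by (rule L2_inner_has_real_derivative[where v = "\<lambda>_ _. 1"])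
          (use x uL2 const jumpL2 u_deriv zero in auto)
      moreover have "L2_inner \<Omega> (k.jump_op (u x)) (\<lambda>_. 1) = 0"
        using k.integral_jump_op[of "u x"] uL2[of x] x by (simp add: L2_inner_def in_L2_def)
      ultimately show "(?F has_real_derivative 0) (at x)" by (simp add: L2_inner_def)
    qed
    then have "(LINT x|?M. u s x) = (LINT x|?M. u 0 x)" by (simp add: L2_inner_def)
    then show ?thesis using mass_init u0 by simp
  qed
  define w where "w s x = u s x - m" for s x
  have wL2: "in_L2 \<Omega> (w s)" if "0 \<le> s" for s
    unfolding w_def using uL2[OF that] const by (rule in_L2_diff)
  have w_mean: "(LINT x|?M. w s x) = 0" if "0 \<le> s" for s
  proof -
    have "integrable ?M (u s)"
      using uL2[OF that] by (auto simp: in_L2_def intro: k.square_integrable_imp_integrable)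
    then show ?thesis using mass[OF that] \<mu> by (simp add: w_def)
  qed
  have jump_w: "k.jump_op (w s) = k.jump_op (u s)" for s
    by (simp add: fun_eq_iff k.jump_op_def w_def)
  let ?e = "\<lambda>s. L2_inner \<Omega> (w s) (w s)"
  have "?e t \<le> ?e 0 * exp (- \<alpha> * t)"
  proof (rule exponential_decay_of_differential_inequality[OF _ _ t])
    show "continuous_on {0..} ?e"
      unfolding continuous_on_def
      using u_cont by (auto intro!: L2_inner_tendsto wL2 simp: w_def)
    fix s :: real assume s: "0 < s"
    have d: "(?e has_real_derivative
        L2_inner \<Omega> (k.jump_op (u s)) (w s) + L2_inner \<Omega> (w s) (k.jump_op (u s))) (at s)"
      by (rule L2_inner_has_real_derivative[OF wL2 wL2 s])
        (use s jumpL2[of s] u_deriv[of s] u_cont0[of s] in \<open>auto simp: w_def\<close>)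
    have "L2_inner \<Omega> (w s) (k.jump_op (u s)) = - k.dirichlet_form (w s) / 2"
      using k.integral_mult_jump_op[of "w s"] wL2[of s] s
      by (simp add: L2_inner_def in_L2_def jump_w)
    moreover have "\<alpha> * ?e s \<le> k.dirichlet_form (w s)"
      using gap[OF wL2 w_mean, of s] s by (simp add: L2_norm_power2)
    ultimately show "\<exists>d. (?e has_real_derivative d) (at s) \<and> d \<le> - \<alpha> * ?e s"
      using d by (auto simp: L2_inner_commute[of _ "k.jump_op (u s)"])
  qed
  moreover have "?e 0 = (L2_norm \<Omega> (\<lambda>x. u0 x - m))\<^sup>2"
    unfolding L2_norm_power2 L2_inner_def w_def
    using u_init uL2[of 0] u0 by (intro integral_cong_AE) (auto simp: in_L2_def)
  ultimately show ?thesis by (simp add: L2_norm_power2 w_def[abs_def])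
qed

section \<open>The two-phase operator as one jump operator\<close>

definition mixed_kernel ::
    "('a \<Rightarrow> 'a \<Rightarrow> real) \<Rightarrow> ('a \<Rightarrow> 'a \<Rightarrow> real) \<Rightarrow> ('a \<Rightarrow> 'a \<Rightarrow> real) \<Rightarrow> 'a set \<Rightarrow> 'a set \<Rightarrow> 'a \<Rightarrow> 'a \<Rightarrow> real" where
  "mixed_kernel J G R A B x y =
     indicator A x * indicator A y * J x y + indicator B x * indicator B y * G x y +
     (indicator A x * indicator B y + indicator B x * indicator A y) * R x y"

lemma mixed_kernel_cases:
  assumes "x \<in> A \<union> B" "y \<in> A \<union> B" "A \<inter> B = {}"
  shows "mixed_kernel J G R A B x y \<in> {J x y, G x y, R x y}"
  using assms by (auto simp: mixed_kernel_def indicator_def)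

lemma admissible_partition_measurable:
  assumes "admissible_partition \<Omega> A B"
  shows "A \<in> sets lebesgue" "B \<in> sets lebesgue"
proof -
  have "A = closure \<Omega> - B" using assms by (auto simp: admissible_partition_def)
  moreover have "open B" using assms by (simp add: admissible_partition_def)
  ultimately show "A \<in> sets lebesgue" "B \<in> sets lebesgue" by auto
qed

lemma mixed_kernel_bounded_symmetric:
  fixes \<Omega> :: "'a::euclidean_space set"
  assumes \<Omega>: "bounded_domain \<Omega>" and part: "admissible_partition \<Omega> A B"
    and ker: "admissible_kernel J" "admissible_kernel G" "admissible_kernel R"
    and bd: "\<And>x y. x \<in> \<Omega> \<Longrightarrow> y \<in> \<Omega> \<Longrightarrow> \<bar>J x y\<bar> \<le> c \<and> \<bar>G x y\<bar> \<le> c \<and> \<bar>R x y\<bar> \<le> c"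
  shows "bounded_symmetric_kernel (lebesgue_on \<Omega>) (mixed_kernel J G R A B) c"
proof -
  let ?M = "lebesgue_on \<Omega>"
  interpret finite_measure ?M
    using \<Omega> by (intro finite_measure_lebesgue_on_bounded_open) (auto simp: bounded_domain_def)
  note [measurable] = admissible_kernel_measurable[OF ker(1)] admissible_kernel_measurable[OF ker(2)]
    admissible_kernel_measurable[OF ker(3)]
  have AB: "x \<in> A \<union> B" if "x \<in> \<Omega>" for x
    using part that closure_subset[of \<Omega>] by (auto simp: admissible_partition_def)
  have disj: "A \<inter> B = {}" using part by (simp add: admissible_partition_def)
  have [measurable]: "(indicator A :: 'a \<Rightarrow> real) \<in> borel_measurable ?M" "(indicator B :: 'a \<Rightarrow> real) \<in> borel_measurable ?M"
    by (rule measurable_restrict_space1[OF borel_measurable_indicator[OF admissible_partition_measurable(1)[OF part]]],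
        rule measurable_restrict_space1[OF borel_measurable_indicator[OF admissible_partition_measurable(2)[OF part]]])
  show ?thesis
  proof unfold_locales
    show "(\<lambda>(x, y). mixed_kernel J G R A B x y) \<in> borel_measurable (?M \<Otimes>\<^sub>M ?M)"
      unfolding mixed_kernel_def by measurable
    fix x y assume "x \<in> space ?M" "y \<in> space ?M"
    then have xy: "x \<in> \<Omega>" "y \<in> \<Omega>" by (auto simp: space_restrict_space)
    show "mixed_kernel J G R A B x y = mixed_kernel J G R A B y x"
      using ker by (simp add: mixed_kernel_def admissible_kernel_def mult.commute add.commute)
    show "\<bar>mixed_kernel J G R A B x y\<bar> \<le> c"
      using mixed_kernel_cases[OF AB[OF xy(1)] AB[OF xy(2)] disj, of J G R] bd[OF xy] by auto
  qed
qed

text \<open>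
  The four integrals of \<open>nonlocal_op\<close> are one integral over \<open>\<Omega>\<close> split along the partition of
  the variable \<open>y\<close>; the phase of \<open>x\<close> selects two of them.
\<close>
lemma nonlocal_op_eq_jump_op:
  fixes \<Omega> :: "'a::euclidean_space set"
  assumes k: "bounded_symmetric_kernel (lebesgue_on \<Omega>) (mixed_kernel J G R A B) c"
    and part: "admissible_partition \<Omega> A B" and f: "in_L2 \<Omega> f" and x: "x \<in> \<Omega>"
  shows "nonlocal_op \<Omega> J G R A B f x
       = bounded_symmetric_kernel.jump_op (lebesgue_on \<Omega>) (mixed_kernel J G R A B) f x"
proof -
  let ?M = "lebesgue_on \<Omega>" and ?k = "mixed_kernel J G R A B"
  interpret k: bounded_symmetric_kernel ?M ?k c by (rule k)
  have f': "f \<in> borel_measurable ?M" "integrable ?M (\<lambda>x. (f x)\<^sup>2)" using f by (auto simp: in_L2_def)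
  have xs: "x \<in> space ?M" using x by (simp add: space_restrict_space)
  have int: "integrable ?M (\<lambda>y. ?k x y * (f y - f x))"
    by (rule k.integrable_jump[OF f' xs])
  have int_on: "integrable ?M (\<lambda>y. indicator S y * (?k x y * (f y - f x)))" if "S \<in> sets lebesgue" for S
  proof (rule Bochner_Integration.integrable_bound[OF int])
    have [measurable]: "(indicator S :: 'a \<Rightarrow> real) \<in> borel_measurable ?M"
      by (rule measurable_restrict_space1[OF borel_measurable_indicator[OF that]])
    note [measurable] = borel_measurable_integrable[OF int]
    show "(\<lambda>y. indicator S y * (?k x y * (f y - f x))) \<in> borel_measurable ?M" by measurable
  qed (auto simp: indicator_def)
  note AB = admissible_partition_measurable[OF part]
  have cover: "\<Omega> \<subseteq> A \<union> B" and disj: "A \<inter> B = {}"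
    using part closure_subset[of \<Omega>] by (auto simp: admissible_partition_def)
  have "(LINT y|?M. ?k x y * (f y - f x))
      = (LINT y|?M. indicator A y * (?k x y * (f y - f x)) + indicator B y * (?k x y * (f y - f x)))"
    using cover disj by (intro Bochner_Integration.integral_cong) (auto simp: indicator_def space_restrict_space)
  also have "\<dots> = (LINT y|?M. indicator A y * (?k x y * (f y - f x))) + (LINT y|?M. indicator B y * (?k x y * (f y - f x)))"
    using int_on AB by simp
  also have "\<dots> = nonlocal_op \<Omega> J G R A B f x"
  proof (cases "x \<in> A")
    case True
    then have "x \<notin> B" using disj by auto
    have "(LINT y|?M. indicator A y * (?k x y * (f y - f x))) = (LINT y|?M. indicator A y * J x y * (f y - f x))"
      "(LINT y|?M. indicator B y * (?k x y * (f y - f x))) = (LINT y|?M. indicator B y * R x y * (f y - f x))"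
      using True disj by (auto intro!: Bochner_Integration.integral_cong simp: indicator_def mixed_kernel_def)
    then show ?thesis using True \<open>x \<notin> B\<close> by (simp add: nonlocal_op_def)
  next
    case False
    then have "x \<in> B" using cover x by auto
    have "(LINT y|?M. indicator A y * (?k x y * (f y - f x))) = (LINT y|?M. indicator A y * R x y * (f y - f x))"
      "(LINT y|?M. indicator B y * (?k x y * (f y - f x))) = (LINT y|?M. indicator B y * G x y * (f y - f x))"
      using False \<open>x \<in> B\<close> disj by (auto intro!: Bochner_Integration.integral_cong simp: indicator_def mixed_kernel_def)
    then show ?thesis using False \<open>x \<in> B\<close> by (simp add: nonlocal_op_def)
  qed
  finally show ?thesis by (simp add: k.jump_op_def)
qed

theorem theorem1p3:
  fixes \<Omega> :: "'a::euclidean_space set"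
    and J G R :: "'a \<Rightarrow> 'a \<Rightarrow> real"
  assumes "bounded_domain \<Omega>"
    and "admissible_kernel J" and "admissible_kernel G" and "admissible_kernel R"
  shows "\<exists>\<alpha>>0. \<forall>u0. in_L2 \<Omega> u0 \<and> probability_density \<Omega> u0 \<longrightarrow>
    (\<exists>C>0. \<forall>A B X u.
       (\<forall>n. admissible_partition \<Omega> (A n) (B n)) \<and>
       mixture_limit \<Omega> A B X \<and>
       (\<forall>n. L2_solution \<Omega> (nonlocal_op \<Omega> J G R (A n) (B n)) u0 (u n)) \<longrightarrow>
       (\<forall>n. \<forall>t\<ge>0. (L2_norm \<Omega> (\<lambda>x. u n t x - 1 / measure lebesgue \<Omega>))\<^sup>2 \<le> C * exp (- \<alpha> * t)))"
proof -
  let ?M = "lebesgue_on \<Omega>" and ?m = "1 / measure lebesgue \<Omega>"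
  have \<Omega>: "open \<Omega>" "\<Omega> \<noteq> {}" "bounded \<Omega>" using assms(1) by (auto simp: bounded_domain_def)
  have comp: "compact (closure \<Omega>)" using \<Omega> by simp
  have sub: "x \<in> closure \<Omega>" if "x \<in> \<Omega>" for x using that closure_subset by blast
  have vol: "measure lebesgue \<Omega> \<noteq> 0"
    using open_not_negligible[OF \<Omega>(1,2)] \<Omega> lmeasurable_open negligible_iff_measure by blast
  obtain cJ cG cR where cs: "\<And>x y. x \<in> closure \<Omega> \<Longrightarrow> y \<in> closure \<Omega> \<Longrightarrow> \<bar>J x y\<bar> \<le> cJ"
    "\<And>x y. x \<in> closure \<Omega> \<Longrightarrow> y \<in> closure \<Omega> \<Longrightarrow> \<bar>G x y\<bar> \<le> cG"
    "\<And>x y. x \<in> closure \<Omega> \<Longrightarrow> y \<in> closure \<Omega> \<Longrightarrow> \<bar>R x y\<bar> \<le> cR"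
    using assms(2-4)[THEN compact_kernel_bounded[OF comp]] by metis
  define c where "c = max cJ (max cG cR)"
  have c: "\<bar>J x y\<bar> \<le> c \<and> \<bar>G x y\<bar> \<le> c \<and> \<bar>R x y\<bar> \<le> c" if "x \<in> \<Omega>" "y \<in> \<Omega>" for x y
    using cs[OF sub[OF that(1)] sub[OF that(2)]] by (auto simp: c_def)
  obtain dJ rJ where J: "0 < dJ" "0 < rJ" "\<And>x y. x \<in> closure \<Omega> \<Longrightarrow> y \<in> closure \<Omega> \<Longrightarrow> dist x y < rJ \<Longrightarrow> dJ \<le> J x y"
    using compact_near_diagonal_lower_bound[OF comp assms(2)] by metis
  obtain dG rG where G: "0 < dG" "0 < rG" "\<And>x y. x \<in> closure \<Omega> \<Longrightarrow> y \<in> closure \<Omega> \<Longrightarrow> dist x y < rG \<Longrightarrow> dG \<le> G x y"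
    using compact_near_diagonal_lower_bound[OF comp assms(3)] by metis
  obtain dR rR where R: "0 < dR" "0 < rR" "\<And>x y. x \<in> closure \<Omega> \<Longrightarrow> y \<in> closure \<Omega> \<Longrightarrow> dist x y < rR \<Longrightarrow> dR \<le> R x y"
    using compact_near_diagonal_lower_bound[OF comp assms(4)] by metis
  define d where "d = min dJ (min dG dR)"
  define r where "r = min rJ (min rG rR)"
  have lower: "d \<le> J x y \<and> d \<le> G x y \<and> d \<le> R x y" if "x \<in> \<Omega>" "y \<in> \<Omega>" "dist x y < r" for x y
    using J(3)[of x y] G(3)[of x y] R(3)[of x y] sub that by (force simp: d_def r_def)
  have "d > 0" "r > 0" using J G R by (auto simp: d_def r_def)
  from jump_spectral_gap[OF assms(1) this] obtain \<alpha> where \<alpha>: "\<alpha> > 0"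
    "\<And>k c f. bounded_symmetric_kernel ?M k c \<Longrightarrow> \<forall>x\<in>\<Omega>. \<forall>y\<in>\<Omega>. 0 \<le> k x y \<Longrightarrow>
      \<forall>x\<in>\<Omega>. \<forall>y\<in>\<Omega>. dist x y < r \<longrightarrow> d \<le> k x y \<Longrightarrow> in_L2 \<Omega> f \<Longrightarrow> (LINT x|?M. f x) = 0 \<Longrightarrow>
      \<alpha> * (L2_norm \<Omega> f)\<^sup>2 \<le> bounded_symmetric_kernel.dirichlet_form ?M k f"
    by blast
  have decay: "(L2_norm \<Omega> (\<lambda>x. u t x - ?m))\<^sup>2 \<le> (L2_norm \<Omega> (\<lambda>x. u0 x - ?m))\<^sup>2 * exp (- \<alpha> * t)"
    if u0: "in_L2 \<Omega> u0" "probability_density \<Omega> u0" and part: "admissible_partition \<Omega> A B"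
      and sol: "L2_solution \<Omega> (nonlocal_op \<Omega> J G R A B) u0 u" and t: "0 \<le> t" for u0 A B u t
  proof -
    let ?k = "mixed_kernel J G R A B"
    have k: "bounded_symmetric_kernel ?M ?k c"
      by (rule mixed_kernel_bounded_symmetric[OF assms(1) part assms(2-4) c])
    have AB: "x \<in> A \<union> B" if "x \<in> \<Omega>" for x
      using part sub[OF that] by (auto simp: admissible_partition_def)
    have "A \<inter> B = {}" using part by (simp add: admissible_partition_def)
    note cases = mixed_kernel_cases[OF AB AB this, of _ _ J G R]
    have k0: "\<forall>x\<in>\<Omega>. \<forall>y\<in>\<Omega>. 0 \<le> ?k x y"
    proof (intro ballI)
      fix x y assume "x \<in> \<Omega>" "y \<in> \<Omega>"
      then show "0 \<le> ?k x y" using cases[of x y] assms(2-4) unfolding admissible_kernel_def by auto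
    qed
    have kd: "\<forall>x\<in>\<Omega>. \<forall>y\<in>\<Omega>. dist x y < r \<longrightarrow> d \<le> ?k x y"
    proof (intro ballI impI)
      fix x y assume "x \<in> \<Omega>" "y \<in> \<Omega>" "dist x y < r"
      then show "d \<le> ?k x y" using cases[of x y] lower[of x y] by auto
    qed
    have "L2_solution \<Omega> (bounded_symmetric_kernel.jump_op ?M ?k) u0 u"
      unfolding L2_solution_def
    proof (intro conjI allI impI)
      fix t :: real assume t: "0 < t"
      then have ut: "in_L2 \<Omega> (u t)" using sol by (simp add: L2_solution_def)
      have eq: "L2_norm \<Omega> (\<lambda>x. (u (t + h) x - u t x) / h - nonlocal_op \<Omega> J G R A B (u t) x)
          = L2_norm \<Omega> (\<lambda>x. (u (t + h) x - u t x) / h - bounded_symmetric_kernel.jump_op ?M ?k (u t) x)" for h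
        unfolding L2_norm_def using nonlocal_op_eq_jump_op[OF k part ut]
        by (intro arg_cong[where f = sqrt] Bochner_Integration.integral_cong) (auto simp: space_restrict_space)
      have "((\<lambda>h. L2_norm \<Omega> (\<lambda>x. (u (t + h) x - u t x) / h - nonlocal_op \<Omega> J G R A B (u t) x)) \<longlongrightarrow> 0) (at 0)"
        using sol t by (simp add: L2_solution_def)
      then show "((\<lambda>h. L2_norm \<Omega> (\<lambda>x. (u (t + h) x - u t x) / h - bounded_symmetric_kernel.jump_op ?M ?k (u t) x)) \<longlongrightarrow> 0) (at 0)"
        unfolding eq .
    qed (use sol in \<open>auto simp: L2_solution_def\<close>)
    moreover have "(LINT x|?M. u0 x) = ?m * measure lebesgue \<Omega>"
      using u0(2) vol by (simp add: probability_density_def has_bochner_integral_integral_eq)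
    ultimately show ?thesis
      using u0(1) by (intro jump_flow_decay[OF assms(1) k \<alpha>(2)[OF k k0 kd] _ _ _ t]) (auto simp: in_L2_def)
  qed
  show ?thesis
  proof (rule exI[of _ \<alpha>], intro conjI allI impI \<alpha>(1))
    fix u0 assume u0: "in_L2 \<Omega> u0 \<and> probability_density \<Omega> u0"
    let ?C = "(L2_norm \<Omega> (\<lambda>x. u0 x - ?m))\<^sup>2 + 1"
    show "\<exists>C>0. \<forall>A B X u.
       (\<forall>n. admissible_partition \<Omega> (A n) (B n)) \<and>
       mixture_limit \<Omega> A B X \<and>
       (\<forall>n. L2_solution \<Omega> (nonlocal_op \<Omega> J G R (A n) (B n)) u0 (u n)) \<longrightarrow>
       (\<forall>n. \<forall>t\<ge>0. (L2_norm \<Omega> (\<lambda>x. u n t x - ?m))\<^sup>2 \<le> C * exp (- \<alpha> * t))"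
    proof (rule exI[of _ ?C], intro conjI allI impI)
      \<comment> \<open>The summand \<open>1\<close> keeps \<open>C\<close> positive when \<open>u0\<close> is already uniform.\<close>
      show "0 < ?C" by (smt (verit) zero_le_power2)
      fix A B X u n t assume h: "(\<forall>n. admissible_partition \<Omega> (A n) (B n)) \<and> mixture_limit \<Omega> A B X \<and>
          (\<forall>n. L2_solution \<Omega> (nonlocal_op \<Omega> J G R (A n) (B n)) u0 (u n))" and t: "0 \<le> (t::real)"
      have "(L2_norm \<Omega> (\<lambda>x. u n t x - ?m))\<^sup>2 \<le> (L2_norm \<Omega> (\<lambda>x. u0 x - ?m))\<^sup>2 * exp (- \<alpha> * t)"
        using u0 h t by (intro decay[of u0 "A n" "B n"]) auto
      also have "\<dots> \<le> ?C * exp (- \<alpha> * t)" by (intro mult_right_mono) auto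
      finally show "(L2_norm \<Omega> (\<lambda>x. u n t x - ?m))\<^sup>2 \<le> ?C * exp (- \<alpha> * t)" .
    qed
  qed
qed

end
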